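(* Let $K\colon P\to\mathbf{SCpx}$ be a poset tower and fix a degree $\ell$. For $k\in\{\ell-1,\ell,\ell+1\}$ let $$0\leftarrow C_k(K)\xleftarrow{\alpha_k}G_k\xleftarrow{p_k^1}R_k\xleftarrow{p_k^2}RR_k$$ be a projective resolution of $C_k(K)$ up to the second term (an exact sequence with $G_k,R_k,RR_k$ projective). For $k\in\{\ell,\ell+1\}$ let $f_k^0\colon G_k\to G_{k-1}$ and $f_k^1\colon R_k\to R_{k-1}$ be lifts of the boundary map $\partial_k$, i.e. $\alpha_{k-1}\circ f_k^0=\partial_k\circ\alpha_k$ and $p_{k-1}^1\circ f_k^1=f_k^0\circ p_k^1$. Let $\vartheta_{\ell+1}\colon G_{\ell+1}\to R_{\ell-1}$ be a morphism with $p_{\ell-1}^1\circ\vartheta_{\ell+1}=f_\ell^0\circ f_{\ell+1}^0$. Then $$G_{\ell-1}\xleftarrow{\begin{pmatrix}f_\ell^0&p_{\ell-1}^1\end{pmatrix}}G_\ell\oplus R_{\ell-1}\xleftarrow{\begin{pmatrix}f_{\ell+1}^0&p_\ell^1&0\\ \vartheta_{\ell+1}&f_\ell^1&p_{\ell-1}^2\end{pmatrix}}G_{\ell+1}\oplus R_\ell\oplus RR_{\ell-1}$$ is a projective implicit representation of $\ker(\partial_\ell)/\operatorname{im}(\partial_{\ell+1})$.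
   Context: $P$ is a finite poset, viewed as a category; $\mathbf{Vec}$ is the category of finite-dimensional $\mathbb F_2$-vector spaces; $\mathbf{SCpx}$ is the category of finite simplicial complexes and simplicial maps. A poset tower is a functor $K\colon P\to\mathbf{SCpx}$. A $P$-persistence module is a functor $P\to\mathbf{Vec}$. $C_\ell(K)$ is the $P$-persistence module such that $C_\ell(K)(x)$ has as basis the $\ell$-simplices of $K(x)$ and $C_\ell(K)(x\le y)$ sends $\sigma$ to $K(x\le y)(\sigma)$ if this is an $\ell$-simplex and to $0$ otherwise; $\partial_\ell\colon C_\ell(K)\to C_{\ell-1}(K)$ is the simplicial boundary map (with $\partial_\ell\circ\partial_{\ell+1}=0$). The elementary projective module $\operatorname{Proj}[x]$ is $\mathbb F_2$ at all $y\ge x$ and $0$ elsewhere, with identity maps between nonzero spaces; a projective module is a finite direct sum of these. A projective implicit representation of $\ker(\partial_\ell)/\operatorname{im}(\partial_{\ell+1})$ is a chain complex segment $D_l\xleftarrow{d_c}D_c\xleftarrow{d_r}D_r$ (so $d_c\circ d_r=0$) of projective modules with $\ker(d_c)/\operatorname{im}(d_r)\cong\ker(\partial_\ell)/\operatorname{im}(\partial_{\ell+1})$. *)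

theory Defs
  imports "HOL-Algebra.AbelCoset" "Jordan_Normal_Form.VS_Connect" "HOL-Library.Z2"
begin

section \<open>Persistence modules over a poset\<close>

definition F2 :: "bit ring" where
  "F2 = class_ring"

record ('p, 'm) pmod =
  pspace :: "'p \<Rightarrow> (bit, 'm) module"
  pmap :: "'p \<Rightarrow> 'p \<Rightarrow> 'm \<Rightarrow> 'm"

text \<open>The value of \<open>pmap M x y\<close> is relevant only for \<open>x \<le> y\<close>, and only on the carrier of
  \<open>pspace M x\<close>.\<close>

definition persistence_module :: "('p::order, 'm) pmod \<Rightarrow> bool" where
  "persistence_module M \<longleftrightarrow>
     (\<forall>x. vectorspace F2 (pspace M x) \<and> vectorspace.fin_dim F2 (pspace M x)) \<and>
     (\<forall>x y. x \<le> y \<longrightarrow> linear_map F2 (pspace M x) (pspace M y) (pmap M x y)) \<and>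
     (\<forall>x. \<forall>v \<in> carrier (pspace M x). pmap M x x v = v) \<and>
     (\<forall>x y z. x \<le> y \<longrightarrow> y \<le> z \<longrightarrow>
        (\<forall>v \<in> carrier (pspace M x). pmap M x z v = pmap M y z (pmap M x y v)))"

definition pmod_hom ::
  "('p::order, 'm) pmod \<Rightarrow> ('p, 'n) pmod \<Rightarrow> ('p \<Rightarrow> 'm \<Rightarrow> 'n) \<Rightarrow> bool" where
  "pmod_hom M N \<phi> \<longleftrightarrow>
     persistence_module M \<and> persistence_module N \<and>
     (\<forall>x. linear_map F2 (pspace M x) (pspace N x) (\<phi> x)) \<and>
     (\<forall>x y. x \<le> y \<longrightarrow>
        (\<forall>v \<in> carrier (pspace M x). \<phi> y (pmap M x y v) = pmap N x y (\<phi> x v)))"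

definition pmod_iso :: "('p::order, 'm) pmod \<Rightarrow> ('p, 'n) pmod \<Rightarrow> bool" where
  "pmod_iso M N \<longleftrightarrow>
     (\<exists>\<phi>. pmod_hom M N \<phi> \<and>
        (\<forall>x. bij_betw (\<phi> x) (carrier (pspace M x)) (carrier (pspace N x))))"

abbreviation pker ::
  "('p, 'm) pmod \<Rightarrow> ('p, 'n) pmod \<Rightarrow> ('p \<Rightarrow> 'm \<Rightarrow> 'n) \<Rightarrow> 'p \<Rightarrow> 'm set" where
  "pker M N \<phi> x \<equiv> mod_hom.ker (pspace M x) (pspace N x) (\<phi> x)"

abbreviation pim :: "('p, 'm) pmod \<Rightarrow> ('p \<Rightarrow> 'm \<Rightarrow> 'n) \<Rightarrow> 'p \<Rightarrow> 'n set" where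
  "pim M \<phi> x \<equiv> mod_hom.im (pspace M x) (\<phi> x)"


section \<open>Direct sums, quotients and homology\<close>

definition pmod_sum ::
  "('p, 'm) pmod \<Rightarrow> ('p, 'n) pmod \<Rightarrow> ('p, 'm \<times> 'n) pmod" (infixr \<open>\<oplus>\<^sub>p\<close> 65) where
  "M \<oplus>\<^sub>p N =
     \<lparr>pspace = (\<lambda>x. direct_sum (pspace M x) (pspace N x)),
      pmap = (\<lambda>x y. map_prod (pmap M x y) (pmap N x y))\<rparr>"

text \<open>In the next two definitions the ring fields \<open>mult\<close> and \<open>one\<close> of the module record are
  junk. The sum is meant for finite \<open>I\<close>, where it agrees with the product.\<close>

definition pmod_Sum :: "'i set \<Rightarrow> ('i \<Rightarrow> ('p, 'm) pmod) \<Rightarrow> ('p, 'i \<Rightarrow> 'm) pmod" where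
  "pmod_Sum I M =
     \<lparr>pspace = (\<lambda>x.
        \<lparr>carrier = (\<Pi>\<^sub>E i\<in>I. carrier (pspace (M i) x)),
         mult = (\<lambda>v w. \<lambda>i\<in>I. \<zero>\<^bsub>pspace (M i) x\<^esub>),
         one = (\<lambda>i\<in>I. \<zero>\<^bsub>pspace (M i) x\<^esub>),
         zero = (\<lambda>i\<in>I. \<zero>\<^bsub>pspace (M i) x\<^esub>),
         add = (\<lambda>v w. \<lambda>i\<in>I. v i \<oplus>\<^bsub>pspace (M i) x\<^esub> w i),
         smult = (\<lambda>a v. \<lambda>i\<in>I. a \<odot>\<^bsub>pspace (M i) x\<^esub> v i)\<rparr>),
      pmap = (\<lambda>x y v. \<lambda>i\<in>I. pmap (M i) x y (v i))\<rparr>"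

definition quotient_space :: "(bit, 'm) module \<Rightarrow> 'm set \<Rightarrow> (bit, 'm set) module" where
  "quotient_space V U =
     \<lparr>carrier = a_rcosets\<^bsub>V\<^esub> U,
      mult = (\<lambda>X Y. U),
      one = U,
      zero = U,
      add = (\<lambda>X Y. X <+>\<^bsub>V\<^esub> Y),
      smult = (\<lambda>a X. \<Union>v\<in>X. U +>\<^bsub>V\<^esub> (a \<odot>\<^bsub>V\<^esub> v))\<rparr>"

definition quotient_pmod :: "('p, 'm) pmod \<Rightarrow> ('p \<Rightarrow> 'm set) \<Rightarrow> ('p, 'm set) pmod" where
  "quotient_pmod M U =
     \<lparr>pspace = (\<lambda>x. quotient_space (pspace M x) (U x)),
      pmap = (\<lambda>x y X. \<Union>v\<in>X. U y +>\<^bsub>pspace M y\<^esub> pmap M x y v)\<rparr>"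

definition sub_pmod :: "('p, 'm) pmod \<Rightarrow> ('p \<Rightarrow> 'm set) \<Rightarrow> ('p, 'm) pmod" where
  "sub_pmod M U = \<lparr>pspace = (\<lambda>x. (pspace M x)\<lparr>carrier := U x\<rparr>), pmap = pmap M\<rparr>"

text \<open>\<open>ker d / im d'\<close> for \<open>A \<leftarrow> B \<leftarrow> C\<close> with maps \<open>d\<close> and \<open>d'\<close>.\<close>

definition homology ::
  "('p, 'a) pmod \<Rightarrow> ('p \<Rightarrow> 'b \<Rightarrow> 'a) \<Rightarrow> ('p, 'b) pmod \<Rightarrow> ('p \<Rightarrow> 'c \<Rightarrow> 'b) \<Rightarrow> ('p, 'c) pmod
     \<Rightarrow> ('p, 'b set) pmod" where
  "homology A d B d' C = quotient_pmod (sub_pmod B (pker B A d)) (pim C d')"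


section \<open>Projective modules\<close>

definition Proj :: "'p::order \<Rightarrow> ('p, bit) pmod" where
  "Proj x =
     \<lparr>pspace = (\<lambda>y.
        \<lparr>carrier = (if x \<le> y then UNIV else {0}),
         mult = (*), one = 1, zero = 0, add = (+), smult = (*)\<rparr>),
      pmap = (\<lambda>y z v. if x \<le> y \<and> x \<le> z then v else 0)\<rparr>"

definition projective :: "('p::order, 'm) pmod \<Rightarrow> bool" where
  "projective M \<longleftrightarrow>
     persistence_module M \<and>
     (\<exists>xs. pmod_iso M (pmod_Sum {..<length xs} (\<lambda>i. Proj (xs ! i))))"

definition projective_resolution2 ::
  "('p::order, 'c) pmod \<Rightarrow> ('p \<Rightarrow> 'g \<Rightarrow> 'c) \<Rightarrow> ('p, 'g) pmod \<Rightarrow> ('p \<Rightarrow> 'r \<Rightarrow> 'g) \<Rightarrow> ('p, 'r) pmod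
     \<Rightarrow> ('p \<Rightarrow> 's \<Rightarrow> 'r) \<Rightarrow> ('p, 's) pmod \<Rightarrow> bool" where
  "projective_resolution2 C \<alpha> G p1 R p2 RR \<longleftrightarrow>
     projective G \<and> projective R \<and> projective RR \<and>
     pmod_hom G C \<alpha> \<and> pmod_hom R G p1 \<and> pmod_hom RR R p2 \<and>
     (\<forall>x. pim G \<alpha> x = carrier (pspace C x)) \<and>
     (\<forall>x. pker G C \<alpha> x = pim R p1 x) \<and>
     (\<forall>x. pker R G p1 x = pim RR p2 x)"

definition projective_implicit_rep ::
  "('p::order, 'h) pmod \<Rightarrow> ('p, 'a) pmod \<Rightarrow> ('p \<Rightarrow> 'b \<Rightarrow> 'a) \<Rightarrow> ('p, 'b) pmod
     \<Rightarrow> ('p \<Rightarrow> 'c \<Rightarrow> 'b) \<Rightarrow> ('p, 'c) pmod \<Rightarrow> bool" where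
  "projective_implicit_rep H Dl dc Dc dr Dr \<longleftrightarrow>
     projective Dl \<and> projective Dc \<and> projective Dr \<and>
     pmod_hom Dc Dl dc \<and> pmod_hom Dr Dc dr \<and>
     (\<forall>x. \<forall>v \<in> carrier (pspace Dr x). dc x (dr x v) = \<zero>\<^bsub>pspace Dl x\<^esub>) \<and>
     pmod_iso (homology Dl dc Dc dr Dr) H"


section \<open>Poset towers and their chains\<close>

text \<open>A complex is the set of its simplices; its vertex set is the union of these.\<close>

definition finite_simplicial_complex :: "'v set set \<Rightarrow> bool" where
  "finite_simplicial_complex X \<longleftrightarrow>
     finite X \<and> (\<forall>\<sigma>\<in>X. finite \<sigma> \<and> \<sigma> \<noteq> {}) \<and>
     (\<forall>\<sigma>\<in>X. \<forall>\<tau>. \<tau> \<subseteq> \<sigma> \<longrightarrow> \<tau> \<noteq> {} \<longrightarrow> \<tau> \<in> X)"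

definition simplicial_map :: "'v set set \<Rightarrow> 'w set set \<Rightarrow> ('v \<Rightarrow> 'w) \<Rightarrow> bool" where
  "simplicial_map X Y f \<longleftrightarrow> (\<forall>\<sigma>\<in>X. f ` \<sigma> \<in> Y)"

record ('p, 'v) tower =
  cpx :: "'p \<Rightarrow> 'v set set"
  cmap :: "'p \<Rightarrow> 'p \<Rightarrow> 'v \<Rightarrow> 'v"

definition poset_tower :: "('p::order, 'v) tower \<Rightarrow> bool" where
  "poset_tower K \<longleftrightarrow>
     (\<forall>x. finite_simplicial_complex (cpx K x)) \<and>
     (\<forall>x y. x \<le> y \<longrightarrow> simplicial_map (cpx K x) (cpx K y) (cmap K x y)) \<and>
     (\<forall>x. \<forall>v \<in> \<Union> (cpx K x). cmap K x x v = v) \<and>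
     (\<forall>x y z. x \<le> y \<longrightarrow> y \<le> z \<longrightarrow>
        (\<forall>v \<in> \<Union> (cpx K x). cmap K x z v = cmap K y z (cmap K x y v)))"

text \<open>Degrees are integers. Simplices are nonempty, so there are none of negative dimension,
  and the chain complex is the unreduced one.\<close>

definition simplices :: "'v set set \<Rightarrow> int \<Rightarrow> 'v set set" where
  "simplices X k = {\<sigma> \<in> X. int (card \<sigma>) = k + 1}"

definition chain_space :: "'v set set \<Rightarrow> int \<Rightarrow> (bit, 'v set \<Rightarrow> bit) module" where
  "chain_space X k = ring.func_space F2 (simplices X k)"

definition chain_of :: "'v set set \<Rightarrow> int \<Rightarrow> 'v set \<Rightarrow> 'v set \<Rightarrow> bit" where
  "chain_of X k \<sigma> = (\<lambda>\<tau>\<in>simplices X k. if \<tau> = \<sigma> then 1 else 0)"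

text \<open>The linear map on \<open>chain_space X k\<close> determined by its values \<open>f\<close> on the basis.\<close>

definition linear_extension ::
  "'v set set \<Rightarrow> int \<Rightarrow> (bit, 'w) module \<Rightarrow> ('v set \<Rightarrow> 'w) \<Rightarrow> ('v set \<Rightarrow> bit) \<Rightarrow> 'w" where
  "linear_extension X k W f c = (\<Oplus>\<^bsub>W\<^esub> \<sigma>\<in>simplices X k. c \<sigma> \<odot>\<^bsub>W\<^esub> f \<sigma>)"

definition chain_pmod :: "int \<Rightarrow> ('p, 'v) tower \<Rightarrow> ('p, 'v set \<Rightarrow> bit) pmod" where
  "chain_pmod k K =
     \<lparr>pspace = (\<lambda>x. chain_space (cpx K x) k),
      pmap = (\<lambda>x y. linear_extension (cpx K x) k (chain_space (cpx K y) k)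
        (\<lambda>\<sigma>. if cmap K x y ` \<sigma> \<in> simplices (cpx K y) k
             then chain_of (cpx K y) k (cmap K x y ` \<sigma>)
             else \<zero>\<^bsub>chain_space (cpx K y) k\<^esub>))\<rparr>"

definition boundary :: "('p, 'v) tower \<Rightarrow> int \<Rightarrow> 'p \<Rightarrow> ('v set \<Rightarrow> bit) \<Rightarrow> 'v set \<Rightarrow> bit" where
  "boundary K k x =
     linear_extension (cpx K x) k (chain_space (cpx K x) (k - 1))
       (\<lambda>\<sigma>. \<Oplus>\<^bsub>chain_space (cpx K x) (k - 1)\<^esub> \<tau>\<in>{\<tau> \<in> simplices (cpx K x) (k - 1). \<tau> \<subseteq> \<sigma>}.
              chain_of (cpx K x) (k - 1) \<tau>)"

end

theory Submission
  imports Defs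
begin

text \<open>The isomorphism sends the class of a cycle \<open>(g, r)\<close> to the class of \<open>\<alpha>\<^sub>l g\<close>. A pair \<open>(g, r)\<close>
  is a cycle iff \<open>f\<^sup>0 g = p\<^sup>1 r\<close>, so by exactness a chain \<open>\<alpha>\<^sub>l g\<close> is a cycle iff \<open>g\<close> extends to a cycle
  \<open>(g, r)\<close>. If \<open>\<alpha>\<^sub>l g\<close> is the boundary of \<open>\<alpha> h\<close>, then \<open>g = f\<^sup>0 h + p\<^sup>1 r'\<close> for some \<open>r'\<close>, and
  \<open>r - \<theta> h - f\<^sup>1 r'\<close> is killed by \<open>p\<^sup>1\<close>, hence comes from \<open>RR\<close>.

  The only properties of the simplicial boundary that enter are that it is a morphism of
  persistence modules with \<open>\<partial> \<partial> = 0\<close>. Both are inherited from the lifts, because the maps \<open>\<alpha>\<close> are surjective.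
  Finite dimension is handled as finiteness of the carrier, which is equivalent over \<open>F2\<close>.\<close>

section \<open>Vector spaces over the field with two elements\<close>

text \<open>The module structures that \<open>mod_hom\<close> asks for are already contained in
  \<open>vectorspace\<close>, so only the map itself remains to be checked.\<close>

lemma linear_map_iff:
  "linear_map K V W f \<longleftrightarrow> vectorspace K V \<and> vectorspace K W \<and> f \<in> LinearCombinations.module_hom K V W"
  by (auto simp: linear_map_def mod_hom_def mod_hom_axioms_def vectorspace_def)

lemma linear_mapI:
  assumes "vectorspace K V" "vectorspace K W"
    and "\<And>v. v \<in> carrier V \<Longrightarrow> f v \<in> carrier W"
    and "\<And>v w. v \<in> carrier V \<Longrightarrow> w \<in> carrier V \<Longrightarrow> f (v \<oplus>\<^bsub>V\<^esub> w) = f v \<oplus>\<^bsub>W\<^esub> f w"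
    and "\<And>c v. c \<in> carrier K \<Longrightarrow> v \<in> carrier V \<Longrightarrow> f (c \<odot>\<^bsub>V\<^esub> v) = c \<odot>\<^bsub>W\<^esub> f v"
  shows "linear_map K V W f"
  using assms by (auto simp: linear_map_iff LinearCombinations.module_hom_def)

text \<open>Here \<open>W\<close> is just a record: each axiom pulls back along \<open>f\<close> to
  \<open>V\<close>, where it holds. As \<open>zero\<close> is an independent field of the record,
  its value must be prescribed separately.\<close>

lemma vectorspace_image:
  assumes V: "vectorspace K V"
    and surj: "f ` carrier V = carrier W"
    and zero: "f \<zero>\<^bsub>V\<^esub> = \<zero>\<^bsub>W\<^esub>"
    and add: "\<And>v w. v \<in> carrier V \<Longrightarrow> w \<in> carrier V \<Longrightarrow> f (v \<oplus>\<^bsub>V\<^esub> w) = f v \<oplus>\<^bsub>W\<^esub> f w"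
    and smult: "\<And>c v. c \<in> carrier K \<Longrightarrow> v \<in> carrier V \<Longrightarrow> f (c \<odot>\<^bsub>V\<^esub> v) = c \<odot>\<^bsub>W\<^esub> f v"
  shows "vectorspace K W"
proof -
  interpret V: vectorspace K V by (rule V)
  have preimage: "\<exists>v\<in>carrier V. w = f v" if "w \<in> carrier W" for w
    using that surj by blast
  have closed: "f v \<in> carrier W" if "v \<in> carrier V" for v
    using that surj by blast
  show ?thesis
  proof (rule vs_criteria; (intro allI ballI impI)?; (elim conjE)?)
    show "field K" ..
    show "\<zero>\<^bsub>W\<^esub> \<in> carrier W"
      using closed[of "\<zero>\<^bsub>V\<^esub>"] zero by simp
  next
    fix v w assume "v \<in> carrier W" "w \<in> carrier W"
    then obtain v' w' where "v' \<in> carrier V" "v = f v'" "w' \<in> carrier V" "w = f w'"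
      using preimage by meson
    then show "v \<oplus>\<^bsub>W\<^esub> w \<in> carrier W" "v \<oplus>\<^bsub>W\<^esub> w = w \<oplus>\<^bsub>W\<^esub> v"
      using closed by (simp_all add: V.a_comm flip: add)
  next
    fix v assume "v \<in> carrier W"
    then obtain v' where v': "v' \<in> carrier V" "v = f v'"
      using preimage by meson
    then have "f (\<ominus>\<^bsub>V\<^esub> v') \<in> carrier W" "v \<oplus>\<^bsub>W\<^esub> f (\<ominus>\<^bsub>V\<^esub> v') = \<zero>\<^bsub>W\<^esub>"
      using closed by (simp_all add: V.r_neg zero flip: add)
    then show "\<exists>u\<in>carrier W. v \<oplus>\<^bsub>W\<^esub> u = \<zero>\<^bsub>W\<^esub>" by blast
    show "v \<oplus>\<^bsub>W\<^esub> \<zero>\<^bsub>W\<^esub> = v" "\<one>\<^bsub>K\<^esub> \<odot>\<^bsub>W\<^esub> v = v"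
      using v' by (simp_all flip: add smult zero)
  next
    fix c v assume "c \<in> carrier K" "v \<in> carrier W"
    then show "c \<odot>\<^bsub>W\<^esub> v \<in> carrier W"
      using preimage closed by (metis V.smult_closed smult)
  next
    fix u v w assume "u \<in> carrier W" "v \<in> carrier W" "w \<in> carrier W"
    then obtain u' v' w' where "u' \<in> carrier V" "u = f u'" "v' \<in> carrier V" "v = f v'"
        "w' \<in> carrier V" "w = f w'"
      using preimage by meson
    then show "u \<oplus>\<^bsub>W\<^esub> v \<oplus>\<^bsub>W\<^esub> w = u \<oplus>\<^bsub>W\<^esub> (v \<oplus>\<^bsub>W\<^esub> w)"
      by (simp add: V.a_assoc flip: add)
  next
    fix a b v assume "a \<in> carrier K" "b \<in> carrier K" "v \<in> carrier W"
    moreover from this obtain v' where "v' \<in> carrier V" "v = f v'"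
      using preimage by meson
    ultimately show "(a \<otimes>\<^bsub>K\<^esub> b) \<odot>\<^bsub>W\<^esub> v = a \<odot>\<^bsub>W\<^esub> (b \<odot>\<^bsub>W\<^esub> v)"
      "(a \<oplus>\<^bsub>K\<^esub> b) \<odot>\<^bsub>W\<^esub> v = a \<odot>\<^bsub>W\<^esub> v \<oplus>\<^bsub>W\<^esub> b \<odot>\<^bsub>W\<^esub> v"
      by (simp_all add: V.smult_assoc1 V.smult_l_distr flip: add smult)
  next
    fix c v w assume "c \<in> carrier K" "v \<in> carrier W" "w \<in> carrier W"
    moreover from this obtain v' w' where "v' \<in> carrier V" "v = f v'" "w' \<in> carrier V" "w = f w'"
      using preimage by meson
    ultimately show "c \<odot>\<^bsub>W\<^esub> (v \<oplus>\<^bsub>W\<^esub> w) = c \<odot>\<^bsub>W\<^esub> v \<oplus>\<^bsub>W\<^esub> c \<odot>\<^bsub>W\<^esub> w"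
      by (simp add: V.smult_r_distr flip: add smult)
  qed
qed

section \<open>Finiteness and characteristic two\<close>

lemma F2_simps [simp]:
  "carrier F2 = UNIV" "\<zero>\<^bsub>F2\<^esub> = 0" "\<one>\<^bsub>F2\<^esub> = 1" "a \<oplus>\<^bsub>F2\<^esub> b = a + b" "a \<otimes>\<^bsub>F2\<^esub> b = a * b"
  by (simp_all add: F2_def)

lemma finite_UNIV_bit: "finite (UNIV :: bit set)"
proof (rule finite_subset)
  show "(UNIV :: bit set) \<subseteq> {0, 1}"
  proof
    show "b \<in> {0, 1}" for b :: bit by (cases b) auto
  qed
qed simp

text \<open>A finite set has only finitely many linear combinations over a finite field; conversely,
  a finite carrier spans itself. Finiteness of the carrier passes at once to the submodules and
  images met below.\<close>

lemma F2_fin_dim_iff: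
  assumes "vectorspace F2 V"
  shows "vectorspace.fin_dim F2 V \<longleftrightarrow> finite (carrier V)"
proof -
  interpret V: vectorspace F2 V by (rule assms)
  show ?thesis
  proof
    assume "V.fin_dim"
    then obtain A where A: "finite A" "A \<subseteq> carrier V" "V.span A = carrier V"
      unfolding V.fin_dim_def by blast
    \<comment> \<open>Restricting the coefficients to \<open>A\<close> makes them elements of a
      finite function space without changing the combination.\<close>
    have "carrier V \<subseteq> (\<lambda>a. V.lincomb a A) ` (A \<rightarrow>\<^sub>E UNIV)"
    proof
      fix v assume "v \<in> carrier V"
      then obtain a where "v = V.lincomb a A"
        using A V.finite_in_span by metis
      then have "v = V.lincomb (restrict a A) A"
        using A by (auto intro: V.lincomb_cong)
      then show "v \<in> (\<lambda>a. V.lincomb a A) ` (A \<rightarrow>\<^sub>E UNIV)"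
        by (intro image_eqI[of _ _ "restrict a A"]) auto
    qed
    then show "finite (carrier V)"
      using A finite_UNIV_bit by (meson finite_PiE finite_imageI finite_subset)
  next
    assume fin: "finite (carrier V)"
    have "V.span (carrier V) = carrier V"
      by (meson V.in_own_span V.span_is_subset2 order_refl subset_antisym)
    then show "V.fin_dim"
      unfolding V.fin_dim_def using fin by blast
  qed
qed

lemma F2_add_self:
  assumes "vectorspace F2 V" "v \<in> carrier V"
  shows "v \<oplus>\<^bsub>V\<^esub> v = \<zero>\<^bsub>V\<^esub>"
proof -
  interpret V: vectorspace F2 V by (rule assms)
  have "v \<oplus>\<^bsub>V\<^esub> v = (1 + 1 :: bit) \<odot>\<^bsub>V\<^esub> v"
    using assms V.smult_l_distr[of 1 1 v] V.smult_one[of v] by simp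
  also have "\<dots> = \<zero>\<^bsub>V\<^esub>"
    using V.lmult_0[of v] assms by simp
  finally show ?thesis .
qed

text \<open>Every vector is its own negative, so sums take the place of differences in all
  comparisons below, including those of cosets.\<close>

lemma F2_add_eq_zero_iff:
  assumes "vectorspace F2 V" "v \<in> carrier V" "w \<in> carrier V"
  shows "v \<oplus>\<^bsub>V\<^esub> w = \<zero>\<^bsub>V\<^esub> \<longleftrightarrow> v = w"
proof -
  interpret V: vectorspace F2 V by (rule assms)
  show ?thesis
    using assms F2_add_self V.a_assoc V.l_zero V.r_zero by metis
qed

section \<open>Morphisms of persistence modules\<close>

lemma persistence_moduleD:
  assumes "persistence_module M"
  shows "vectorspace F2 (pspace M x)" "finite (carrier (pspace M x))"
    and "x \<le> y \<Longrightarrow> linear_map F2 (pspace M x) (pspace M y) (pmap M x y)"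
    and "x \<le> y \<Longrightarrow> v \<in> carrier (pspace M x) \<Longrightarrow> pmap M x y v \<in> carrier (pspace M y)"
    and "v \<in> carrier (pspace M x) \<Longrightarrow> pmap M x x v = v"
    and "x \<le> y \<Longrightarrow> y \<le> z \<Longrightarrow> v \<in> carrier (pspace M x) \<Longrightarrow>
      pmap M y z (pmap M x y v) = pmap M x z v"
proof -
  show vs: "vectorspace F2 (pspace M x)"
    using assms by (simp add: persistence_module_def)
  show "finite (carrier (pspace M x))"
    using assms F2_fin_dim_iff[OF vs] by (simp add: persistence_module_def)
  show lin: "linear_map F2 (pspace M x) (pspace M y) (pmap M x y)" if "x \<le> y"
    using assms that by (simp add: persistence_module_def)
  show "pmap M x y v \<in> carrier (pspace M y)" if "x \<le> y" "v \<in> carrier (pspace M x)"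
    using lin[OF that(1)] that(2) by (auto simp: linear_map_iff LinearCombinations.module_hom_def)
  show "v \<in> carrier (pspace M x) \<Longrightarrow> pmap M x x v = v"
    using assms by (simp add: persistence_module_def)
  show "x \<le> y \<Longrightarrow> y \<le> z \<Longrightarrow> v \<in> carrier (pspace M x) \<Longrightarrow>
      pmap M y z (pmap M x y v) = pmap M x z v"
    using assms unfolding persistence_module_def by metis
qed

lemma persistence_moduleI:
  assumes "\<And>x. vectorspace F2 (pspace M x)" "\<And>x. finite (carrier (pspace M x))"
    and "\<And>x y. x \<le> y \<Longrightarrow> linear_map F2 (pspace M x) (pspace M y) (pmap M x y)"
    and "\<And>x v. v \<in> carrier (pspace M x) \<Longrightarrow> pmap M x x v = v"
    and "\<And>x y z v. x \<le> y \<Longrightarrow> y \<le> z \<Longrightarrow> v \<in> carrier (pspace M x) \<Longrightarrow>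
      pmap M y z (pmap M x y v) = pmap M x z v"
  shows "persistence_module M"
  using assms by (simp add: persistence_module_def F2_fin_dim_iff)

lemma pmod_homD:
  assumes "pmod_hom M N \<phi>"
  shows "persistence_module M" "persistence_module N"
    and "linear_map F2 (pspace M x) (pspace N x) (\<phi> x)"
    and "v \<in> carrier (pspace M x) \<Longrightarrow> \<phi> x v \<in> carrier (pspace N x)"
    and "\<phi> x \<zero>\<^bsub>pspace M x\<^esub> = \<zero>\<^bsub>pspace N x\<^esub>"
    and "v \<in> carrier (pspace M x) \<Longrightarrow> w \<in> carrier (pspace M x) \<Longrightarrow>
      \<phi> x (v \<oplus>\<^bsub>pspace M x\<^esub> w) = \<phi> x v \<oplus>\<^bsub>pspace N x\<^esub> \<phi> x w"
    and "v \<in> carrier (pspace M x) \<Longrightarrow> \<phi> x (c \<odot>\<^bsub>pspace M x\<^esub> v) = c \<odot>\<^bsub>pspace N x\<^esub> \<phi> x v"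
    and "x \<le> y \<Longrightarrow> v \<in> carrier (pspace M x) \<Longrightarrow> \<phi> y (pmap M x y v) = pmap N x y (\<phi> x v)"
proof -
  show "persistence_module M" "persistence_module N"
    and lin: "linear_map F2 (pspace M x) (pspace N x) (\<phi> x)"
    using assms by (simp_all add: pmod_hom_def)
  interpret linear_map F2 "pspace M x" "pspace N x" "\<phi> x" by (rule lin)
  show "v \<in> carrier (pspace M x) \<Longrightarrow> \<phi> x v \<in> carrier (pspace N x)"
    "\<phi> x \<zero>\<^bsub>pspace M x\<^esub> = \<zero>\<^bsub>pspace N x\<^esub>"
    "v \<in> carrier (pspace M x) \<Longrightarrow> w \<in> carrier (pspace M x) \<Longrightarrow>
      \<phi> x (v \<oplus>\<^bsub>pspace M x\<^esub> w) = \<phi> x v \<oplus>\<^bsub>pspace N x\<^esub> \<phi> x w"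
    "v \<in> carrier (pspace M x) \<Longrightarrow> \<phi> x (c \<odot>\<^bsub>pspace M x\<^esub> v) = c \<odot>\<^bsub>pspace N x\<^esub> \<phi> x v"
    by simp_all
  show "x \<le> y \<Longrightarrow> v \<in> carrier (pspace M x) \<Longrightarrow> \<phi> y (pmap M x y v) = pmap N x y (\<phi> x v)"
    using assms by (simp add: pmod_hom_def)
qed

lemma pmod_homI:
  assumes "persistence_module M" "persistence_module N"
    and "\<And>x v. v \<in> carrier (pspace M x) \<Longrightarrow> \<phi> x v \<in> carrier (pspace N x)"
    and "\<And>x v w. v \<in> carrier (pspace M x) \<Longrightarrow> w \<in> carrier (pspace M x) \<Longrightarrow>
      \<phi> x (v \<oplus>\<^bsub>pspace M x\<^esub> w) = \<phi> x v \<oplus>\<^bsub>pspace N x\<^esub> \<phi> x w"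
    and "\<And>x c v. v \<in> carrier (pspace M x) \<Longrightarrow>
      \<phi> x (c \<odot>\<^bsub>pspace M x\<^esub> v) = c \<odot>\<^bsub>pspace N x\<^esub> \<phi> x v"
    and "\<And>x y v. x \<le> y \<Longrightarrow> v \<in> carrier (pspace M x) \<Longrightarrow>
      \<phi> y (pmap M x y v) = pmap N x y (\<phi> x v)"
  shows "pmod_hom M N \<phi>"
  using assms by (auto simp: pmod_hom_def persistence_moduleD(1) intro!: linear_mapI)

lemma pmod_spaceD:
  assumes "persistence_module M"
  shows "\<zero>\<^bsub>pspace M x\<^esub> \<in> carrier (pspace M x)"
    and "v \<in> carrier (pspace M x) \<Longrightarrow> w \<in> carrier (pspace M x) \<Longrightarrow>
      v \<oplus>\<^bsub>pspace M x\<^esub> w \<in> carrier (pspace M x)"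
    and "v \<in> carrier (pspace M x) \<Longrightarrow> c \<odot>\<^bsub>pspace M x\<^esub> v \<in> carrier (pspace M x)"
    and "v \<in> carrier (pspace M x) \<Longrightarrow> w \<in> carrier (pspace M x) \<Longrightarrow>
      v \<oplus>\<^bsub>pspace M x\<^esub> w = \<zero>\<^bsub>pspace M x\<^esub> \<longleftrightarrow> v = w"
proof -
  interpret vectorspace F2 "pspace M x" by (rule persistence_moduleD(1)[OF assms])
  show "\<zero>\<^bsub>pspace M x\<^esub> \<in> carrier (pspace M x)"
    "v \<in> carrier (pspace M x) \<Longrightarrow> w \<in> carrier (pspace M x) \<Longrightarrow>
      v \<oplus>\<^bsub>pspace M x\<^esub> w \<in> carrier (pspace M x)"
    "v \<in> carrier (pspace M x) \<Longrightarrow> c \<odot>\<^bsub>pspace M x\<^esub> v \<in> carrier (pspace M x)"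
    by simp_all
  show "v \<in> carrier (pspace M x) \<Longrightarrow> w \<in> carrier (pspace M x) \<Longrightarrow>
      v \<oplus>\<^bsub>pspace M x\<^esub> w = \<zero>\<^bsub>pspace M x\<^esub> \<longleftrightarrow> v = w"
    by (rule F2_add_eq_zero_iff[OF persistence_moduleD(1)[OF assms]])
qed

text \<open>The target is only a record of operations. Surjectivity carries its axioms over from
  \<open>M\<close>, and naturality forces its structure maps to be linear and functorial. This is
  how finite direct sums and quotients are recognised as persistence modules.\<close>

lemma persistence_module_image:
  assumes M: "persistence_module M"
    and surj: "\<And>x. \<phi> x ` carrier (pspace M x) = carrier (pspace N x)"
    and zero: "\<And>x. \<phi> x \<zero>\<^bsub>pspace M x\<^esub> = \<zero>\<^bsub>pspace N x\<^esub>"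
    and add: "\<And>x v w. v \<in> carrier (pspace M x) \<Longrightarrow> w \<in> carrier (pspace M x) \<Longrightarrow>
      \<phi> x (v \<oplus>\<^bsub>pspace M x\<^esub> w) = \<phi> x v \<oplus>\<^bsub>pspace N x\<^esub> \<phi> x w"
    and smult: "\<And>x c v. v \<in> carrier (pspace M x) \<Longrightarrow>
      \<phi> x (c \<odot>\<^bsub>pspace M x\<^esub> v) = c \<odot>\<^bsub>pspace N x\<^esub> \<phi> x v"
    and nat: "\<And>x y v. x \<le> y \<Longrightarrow> v \<in> carrier (pspace M x) \<Longrightarrow>
      \<phi> y (pmap M x y v) = pmap N x y (\<phi> x v)"
  shows "pmod_hom M N \<phi>"
proof -
  note MD = persistence_moduleD[OF M] and MS = pmod_spaceD[OF M]
  have preimage: "\<exists>v\<in>carrier (pspace M x). w = \<phi> x v" if "w \<in> carrier (pspace N x)" for x w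
    using that surj by blast
  have closed: "\<phi> x v \<in> carrier (pspace N x)" if "v \<in> carrier (pspace M x)" for x v
    using that surj by blast
  have vs: "vectorspace F2 (pspace N x)" for x
    by (rule vectorspace_image[OF MD(1)[of x] surj zero add smult])
  have "persistence_module N"
  proof (rule persistence_moduleI)
    show "vectorspace F2 (pspace N x)" for x by (rule vs)
    show "finite (carrier (pspace N x))" for x
      using MD(2)[of x] surj by (metis finite_imageI)
  next
    fix x y :: 'a assume le: "x \<le> y"
    interpret linear_map F2 "pspace M x" "pspace M y" "pmap M x y" by (rule MD(3)[OF le])
    show "linear_map F2 (pspace N x) (pspace N y) (pmap N x y)"
    proof (rule linear_mapI)
      fix v w assume "v \<in> carrier (pspace N x)" "w \<in> carrier (pspace N x)"
      then obtain v' w' where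
        v: "v' \<in> carrier (pspace M x)" "v = \<phi> x v'" and w: "w' \<in> carrier (pspace M x)" "w = \<phi> x w'"
        using preimage by meson
      have "pmap N x y (v \<oplus>\<^bsub>pspace N x\<^esub> w) = \<phi> y (pmap M x y (v' \<oplus>\<^bsub>pspace M x\<^esub> w'))"
        using v w le add nat MS(2) by metis
      also have "\<dots> = pmap N x y v \<oplus>\<^bsub>pspace N y\<^esub> pmap N x y w"
        using v w le by (simp add: add MD flip: nat)
      finally show "pmap N x y (v \<oplus>\<^bsub>pspace N x\<^esub> w) = pmap N x y v \<oplus>\<^bsub>pspace N y\<^esub> pmap N x y w" .
    next
      fix c :: bit and v assume "v \<in> carrier (pspace N x)"
      then obtain v' where v: "v' \<in> carrier (pspace M x)" "v = \<phi> x v'"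
        using preimage by meson
      have "pmap N x y (c \<odot>\<^bsub>pspace N x\<^esub> v) = \<phi> y (pmap M x y (c \<odot>\<^bsub>pspace M x\<^esub> v'))"
        using v le smult nat MS(3) by metis
      also have "\<dots> = c \<odot>\<^bsub>pspace N y\<^esub> pmap N x y v"
        using v le by (simp add: smult MD flip: nat)
      finally show "pmap N x y (c \<odot>\<^bsub>pspace N x\<^esub> v) = c \<odot>\<^bsub>pspace N y\<^esub> pmap N x y v" .
    next
      fix v assume "v \<in> carrier (pspace N x)"
      then show "pmap N x y v \<in> carrier (pspace N y)"
        using preimage closed MD(4) le nat by metis
    qed (rule vs)+
  next
    show "pmap N x x v = v" if "v \<in> carrier (pspace N x)" for x v
      using that preimage MD(5) nat by (metis order_refl)
    show "pmap N y z (pmap N x y v) = pmap N x z v"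
      if "x \<le> y" "y \<le> z" "v \<in> carrier (pspace N x)" for x y z v
    proof -
      obtain v' where v: "v' \<in> carrier (pspace M x)" "v = \<phi> x v'"
        using preimage[OF \<open>v \<in> carrier (pspace N x)\<close>] by blast
      moreover have "x \<le> z"
        using that by order
      ultimately show ?thesis
        using that MD by (simp flip: nat)
    qed
  qed
  then show ?thesis
    by (intro pmod_homI M closed add smult nat)
qed

lemma pmod_hom_compose:
  assumes "pmod_hom L M \<phi>" "pmod_hom M N \<psi>"
  shows "pmod_hom L N (\<lambda>x v. \<psi> x (\<phi> x v))"
  using pmod_homD[OF assms(1)] pmod_homD[OF assms(2)] by (intro pmod_homI) auto

text \<open>Together with composition, projections and pairing, sums let the block matrices of the
  theorem be assembled as morphisms from their entries.\<close>

lemma pmod_hom_add: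
  assumes \<phi>: "pmod_hom M N \<phi>" and \<psi>: "pmod_hom M N \<psi>"
  shows "pmod_hom M N (\<lambda>x v. \<phi> x v \<oplus>\<^bsub>pspace N x\<^esub> \<psi> x v)"
proof (rule pmod_homI)
  note D = pmod_homD[OF \<phi>] pmod_homD[OF \<psi>]
  note N = pmod_homD(2)[OF \<phi>]
  show "persistence_module M" "persistence_module N" by (rule D)+
  fix x
  interpret N: vectorspace F2 "pspace N x" by (rule persistence_moduleD(1)[OF N])
  fix v assume v: "v \<in> carrier (pspace M x)"
  show "\<phi> x v \<oplus>\<^bsub>pspace N x\<^esub> \<psi> x v \<in> carrier (pspace N x)"
    using v D by simp
  show "\<phi> x (c \<odot>\<^bsub>pspace M x\<^esub> v) \<oplus>\<^bsub>pspace N x\<^esub> \<psi> x (c \<odot>\<^bsub>pspace M x\<^esub> v) =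
      c \<odot>\<^bsub>pspace N x\<^esub> (\<phi> x v \<oplus>\<^bsub>pspace N x\<^esub> \<psi> x v)" for c
    using v D by (simp add: N.smult_r_distr)
  show "\<phi> x (v \<oplus>\<^bsub>pspace M x\<^esub> w) \<oplus>\<^bsub>pspace N x\<^esub> \<psi> x (v \<oplus>\<^bsub>pspace M x\<^esub> w) =
      (\<phi> x v \<oplus>\<^bsub>pspace N x\<^esub> \<psi> x v) \<oplus>\<^bsub>pspace N x\<^esub> (\<phi> x w \<oplus>\<^bsub>pspace N x\<^esub> \<psi> x w)"
    if "w \<in> carrier (pspace M x)" for w
    using v that D by (simp add: N.a_ac)
  fix y assume le: "x \<le> y"
  interpret linear_map F2 "pspace N x" "pspace N y" "pmap N x y"
    by (rule persistence_moduleD(3)[OF N le])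
  show "\<phi> y (pmap M x y v) \<oplus>\<^bsub>pspace N y\<^esub> \<psi> y (pmap M x y v) =
      pmap N x y (\<phi> x v \<oplus>\<^bsub>pspace N x\<^esub> \<psi> x v)"
    using v D le by simp
qed

text \<open>As \<alpha> is onto, linearity and naturality of \<open>d\<close> can be tested on
  values of \<alpha>, where \<open>d\<close> is given by \<open>h\<close>. This serves for the
  boundary maps, with no calculation in terms of simplices, and for maps out of quotients.\<close>

lemma pmod_hom_descend:
  assumes \<alpha>: "pmod_hom G C \<alpha>" and h: "pmod_hom G N h"
    and surj: "\<And>x. \<alpha> x ` carrier (pspace G x) = carrier (pspace C x)"
    and lift: "\<And>x v. v \<in> carrier (pspace G x) \<Longrightarrow> d x (\<alpha> x v) = h x v"
  shows "pmod_hom C N d"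
proof (rule pmod_homI)
  note A = pmod_homD[OF \<alpha>] and H = pmod_homD[OF h]
  note G = pmod_spaceD[OF A(1)] persistence_moduleD[OF A(1)]
  have preimage: "\<exists>v\<in>carrier (pspace G x). w = \<alpha> x v" if "w \<in> carrier (pspace C x)" for x w
    using that surj by blast
  show "persistence_module C" by (rule A)
  show "persistence_module N" by (rule H)
  fix x v assume "v \<in> carrier (pspace C x)"
  then obtain v' where v: "v' \<in> carrier (pspace G x)" "v = \<alpha> x v'"
    using preimage by meson
  show "d x v \<in> carrier (pspace N x)"
    using v H by (simp add: lift)
  have "d x (c \<odot>\<^bsub>pspace C x\<^esub> v) = d x (\<alpha> x (c \<odot>\<^bsub>pspace G x\<^esub> v'))" for c
    using v A by simp
  then show "d x (c \<odot>\<^bsub>pspace C x\<^esub> v) = c \<odot>\<^bsub>pspace N x\<^esub> d x v" for c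
    using v H G by (simp add: lift)
  show "d x (v \<oplus>\<^bsub>pspace C x\<^esub> w) = d x v \<oplus>\<^bsub>pspace N x\<^esub> d x w"
    if w_in: "w \<in> carrier (pspace C x)" for w
  proof -
    obtain w' where w: "w' \<in> carrier (pspace G x)" "w = \<alpha> x w'"
      using preimage[OF w_in] by blast
    have "d x (v \<oplus>\<^bsub>pspace C x\<^esub> w) = d x (\<alpha> x (v' \<oplus>\<^bsub>pspace G x\<^esub> w'))"
      using v w A by simp
    then show ?thesis
      using v w H G by (simp add: lift)
  qed
  fix y assume le: "x \<le> y"
  have "d y (pmap C x y v) = d y (\<alpha> y (pmap G x y v'))"
    using v A le by simp
  then show "d y (pmap C x y v) = pmap N x y (d x v)"
    using v H G le by (simp add: lift)
qed

text \<open>The locale constant \<open>mod_hom.ker\<close> unfolds only under the assumption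
  \<open>mod_hom\<close>, which a morphism provides at each point; the same holds for
  \<open>mod_hom.im\<close> below.\<close>

lemma pker_eq:
  assumes "pmod_hom M N \<phi>"
  shows "pker M N \<phi> x = {v \<in> carrier (pspace M x). \<phi> x v = \<zero>\<^bsub>pspace N x\<^esub>}"
  by (rule mod_hom.ker_def[OF linear_map.axioms(3)[OF pmod_homD(3)[OF assms]]])

lemma pim_eq:
  assumes "pmod_hom M N \<phi>"
  shows "pim M \<phi> x = \<phi> x ` carrier (pspace M x)"
  by (rule mod_hom.im_def[OF linear_map.axioms(3)[OF pmod_homD(3)[OF assms]]])

lemma pker_submodule:
  assumes "pmod_hom M N \<phi>"
  shows "submodule F2 (pker M N \<phi> x) (pspace M x)"
  using linear_map.kerT_is_subspace[OF pmod_homD(3)[OF assms]] by (simp add: subspace_def)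

lemma pim_submodule:
  assumes "pmod_hom M N \<phi>"
  shows "submodule F2 (pim M \<phi> x) (pspace N x)"
  using linear_map.imT_is_subspace[OF pmod_homD(3)[OF assms]] by (simp add: subspace_def)

lemma pmap_zero:
  assumes "persistence_module M" "x \<le> y"
  shows "pmap M x y \<zero>\<^bsub>pspace M x\<^esub> = \<zero>\<^bsub>pspace M y\<^esub>"
  by (rule mod_hom.f0_is_0[OF linear_map.axioms(3)[OF persistence_moduleD(3)[OF assms]]])

text \<open>Naturality commutes \<phi> past the structure map, which preserves zero. This stability
  makes the kernel a persistence module itself.\<close>

lemma pmap_pker:
  assumes \<phi>: "pmod_hom M N \<phi>" and "x \<le> y" "v \<in> pker M N \<phi> x"
  shows "pmap M x y v \<in> pker M N \<phi> y"
  using assms(2,3) pmod_homD[OF \<phi>] by (auto simp: pker_eq[OF \<phi>] persistence_moduleD(4) pmap_zero)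

section \<open>Direct sums\<close>

lemma direct_sum_simps [simp]:
  "carrier (direct_sum V W) = carrier V \<times> carrier W"
  "\<zero>\<^bsub>direct_sum V W\<^esub> = (\<zero>\<^bsub>V\<^esub>, \<zero>\<^bsub>W\<^esub>)"
  "p \<oplus>\<^bsub>direct_sum V W\<^esub> q = (fst p \<oplus>\<^bsub>V\<^esub> fst q, snd p \<oplus>\<^bsub>W\<^esub> snd q)"
  "c \<odot>\<^bsub>direct_sum V W\<^esub> p = (c \<odot>\<^bsub>V\<^esub> fst p, c \<odot>\<^bsub>W\<^esub> snd p)"
  by (simp_all add: direct_sum_def)

lemma pmod_sum_simps [simp]:
  "pspace (M \<oplus>\<^sub>p N) x = direct_sum (pspace M x) (pspace N x)"
  "pmap (M \<oplus>\<^sub>p N) x y = map_prod (pmap M x y) (pmap N x y)"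
  by (simp_all add: pmod_sum_def)

lemma persistence_module_sum:
  assumes "persistence_module M" "persistence_module N"
  shows "persistence_module (M \<oplus>\<^sub>p N)"
proof (rule persistence_moduleI)
  note D = persistence_moduleD[OF assms(1)] persistence_moduleD[OF assms(2)]
  show vs: "vectorspace F2 (pspace (M \<oplus>\<^sub>p N) x)" for x
    using direct_sum_is_module[of F2 "pspace M x" "pspace N x"] D(1,7)[of x]
    by (simp add: vectorspace_def)
  show "linear_map F2 (pspace (M \<oplus>\<^sub>p N) x) (pspace (M \<oplus>\<^sub>p N) y) (pmap (M \<oplus>\<^sub>p N) x y)"
    if "x \<le> y" for x y
  proof -
    interpret M: linear_map F2 "pspace M x" "pspace M y" "pmap M x y"
      by (rule persistence_moduleD(3)[OF assms(1) that])
    interpret N: linear_map F2 "pspace N x" "pspace N y" "pmap N x y"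
      by (rule persistence_moduleD(3)[OF assms(2) that])
    show ?thesis
      by (rule linear_mapI[OF vs vs]) auto
  qed
qed (use persistence_moduleD[OF assms(1)] persistence_moduleD[OF assms(2)] in auto)

lemma pmod_hom_fst:
  assumes "persistence_module M" "persistence_module N"
  shows "pmod_hom (M \<oplus>\<^sub>p N) M (\<lambda>x. fst)"
  by (rule pmod_homI) (use assms persistence_module_sum in auto)

lemma pmod_hom_snd:
  assumes "persistence_module M" "persistence_module N"
  shows "pmod_hom (M \<oplus>\<^sub>p N) N (\<lambda>x. snd)"
  by (rule pmod_homI) (use assms persistence_module_sum in auto)

lemma pmod_hom_pair:
  assumes "pmod_hom L M \<phi>" "pmod_hom L N \<psi>"
  shows "pmod_hom L (M \<oplus>\<^sub>p N) (\<lambda>x v. (\<phi> x v, \<psi> x v))"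
  using pmod_homD[OF assms(1)] pmod_homD[OF assms(2)]
  by (intro pmod_homI persistence_module_sum) auto

section \<open>Finite sums of elementary projectives\<close>

lemma pmod_Sum_simps [simp]:
  "carrier (pspace (pmod_Sum I M) x) = (\<Pi>\<^sub>E i\<in>I. carrier (pspace (M i) x))"
  "\<zero>\<^bsub>pspace (pmod_Sum I M) x\<^esub> = (\<lambda>i\<in>I. \<zero>\<^bsub>pspace (M i) x\<^esub>)"
  "v \<oplus>\<^bsub>pspace (pmod_Sum I M) x\<^esub> w = (\<lambda>i\<in>I. v i \<oplus>\<^bsub>pspace (M i) x\<^esub> w i)"
  "c \<odot>\<^bsub>pspace (pmod_Sum I M) x\<^esub> v = (\<lambda>i\<in>I. c \<odot>\<^bsub>pspace (M i) x\<^esub> v i)"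
  "pmap (pmod_Sum I M) x y v = (\<lambda>i\<in>I. pmap (M i) x y (v i))"
  by (simp_all add: pmod_Sum_def)

text \<open>Concatenating the lists of generators of the two summands gives a list for the sum; the
  two isomorphisms act on consecutive blocks of coordinates.\<close>

lemma projective_sum:
  assumes "projective M" "projective N"
  shows "projective (M \<oplus>\<^sub>p N)"
proof -
  obtain xs \<phi> where \<phi>: "pmod_hom M (pmod_Sum {..<length xs} (\<lambda>i. Proj (xs ! i))) \<phi>"
    and \<phi>_bij: "\<And>x. bij_betw (\<phi> x) (carrier (pspace M x))
      (\<Pi>\<^sub>E i\<in>{..<length xs}. carrier (pspace (Proj (xs ! i)) x))"
    using assms(1) by (auto simp: projective_def pmod_iso_def)
  obtain ys \<psi> where \<psi>: "pmod_hom N (pmod_Sum {..<length ys} (\<lambda>i. Proj (ys ! i))) \<psi>"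
    and \<psi>_bij: "\<And>x. bij_betw (\<psi> x) (carrier (pspace N x))
      (\<Pi>\<^sub>E i\<in>{..<length ys}. carrier (pspace (Proj (ys ! i)) x))"
    using assms(2) by (auto simp: projective_def pmod_iso_def)
  note \<phi>D = pmod_homD[OF \<phi>] and \<psi>D = pmod_homD[OF \<psi>]
  let ?m = "length xs" and ?n = "length ys"
  let ?S = "pmod_Sum {..<length (xs @ ys)} (\<lambda>i. Proj ((xs @ ys) ! i))"
  \<comment> \<open>The first \<open>?m\<close> coordinates come from \<phi>, the others from \<psi>
    with the index shifted by \<open>?m\<close>. The outer restriction makes the value extensional
    on the concatenated range.\<close>
  define \<chi> where "\<chi> x p = (\<lambda>i\<in>{..<?m + ?n}. if i < ?m then \<phi> x (fst p) i else \<psi> x (snd p) (i - ?m))"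
    for x p
  have sum: "persistence_module (M \<oplus>\<^sub>p N)"
    using persistence_module_sum \<phi>D(1) \<psi>D(1) by blast
  have closed: "\<chi> x p \<in> carrier (pspace ?S x)" if "p \<in> carrier (pspace (M \<oplus>\<^sub>p N) x)" for x p
  proof -
    have "\<phi> x (fst p) \<in> (\<Pi>\<^sub>E i\<in>{..<?m}. carrier (pspace (Proj (xs ! i)) x))"
      "\<psi> x (snd p) \<in> (\<Pi>\<^sub>E i\<in>{..<?n}. carrier (pspace (Proj (ys ! i)) x))"
      using that \<phi>D(4)[of "fst p" x] \<psi>D(4)[of "snd p" x] by auto
    then show ?thesis
      by (fastforce simp: \<chi>_def nth_append PiE_iff)
  qed
  have bij: "bij_betw (\<chi> x) (carrier (pspace (M \<oplus>\<^sub>p N) x)) (carrier (pspace ?S x))" for x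
  proof (rule bij_betw_imageI)
    show "inj_on (\<chi> x) (carrier (pspace (M \<oplus>\<^sub>p N) x))"
    proof (rule inj_onI)
      fix p q
      assume p: "p \<in> carrier (pspace (M \<oplus>\<^sub>p N) x)" and q: "q \<in> carrier (pspace (M \<oplus>\<^sub>p N) x)"
        and eq: "\<chi> x p = \<chi> x q"
      have "\<phi> x (fst p) i = \<phi> x (fst q) i" if "i < ?m" for i
        using fun_cong[OF eq, of i] that by (simp add: \<chi>_def)
      moreover have "\<psi> x (snd p) i = \<psi> x (snd q) i" if "i < ?n" for i
        using fun_cong[OF eq, of "?m + i"] that by (simp add: \<chi>_def)
      \<comment> \<open>Membership in the extensional products is recorded because such functions
        are determined by their values on the index range.\<close>
      moreover have "\<phi> x (fst r) \<in> (\<Pi>\<^sub>E i\<in>{..<?m}. carrier (pspace (Proj (xs ! i)) x))"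
        "\<psi> x (snd r) \<in> (\<Pi>\<^sub>E i\<in>{..<?n}. carrier (pspace (Proj (ys ! i)) x))"
        if "r \<in> carrier (pspace (M \<oplus>\<^sub>p N) x)" for r
        using that \<phi>D(4)[of "fst r" x] \<psi>D(4)[of "snd r" x] by auto
      ultimately have "\<phi> x (fst p) = \<phi> x (fst q)" "\<psi> x (snd p) = \<psi> x (snd q)"
        using p q by (meson PiE_ext lessThan_iff)+
      then have "fst p = fst q" "snd p = snd q"
        using p q inj_onD[OF bij_betw_imp_inj_on[OF \<phi>_bij]]
          inj_onD[OF bij_betw_imp_inj_on[OF \<psi>_bij]] by auto
      then show "p = q" by (rule prod_eqI)
    qed
    show "\<chi> x ` carrier (pspace (M \<oplus>\<^sub>p N) x) = carrier (pspace ?S x)"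
    proof (intro equalityI subsetI)
      show "v \<in> carrier (pspace ?S x)" if "v \<in> \<chi> x ` carrier (pspace (M \<oplus>\<^sub>p N) x)" for v
        using that closed by blast
    next
      fix v assume v: "v \<in> carrier (pspace ?S x)"
      have v_in: "v i \<in> carrier (pspace (Proj ((xs @ ys) ! i)) x)" if "i < ?m + ?n" for i
        using v that by auto
      \<comment> \<open>The coordinates of \<open>v\<close> are cut into two blocks, the second
        moved back to start at 0, and each block is lifted separately.\<close>
      let ?v = "\<lambda>i\<in>{..<?m}. v i" and ?w = "\<lambda>i\<in>{..<?n}. v (?m + i)"
      have "v i \<in> carrier (pspace (Proj (xs ! i)) x)" if "i < ?m" for i
        using v_in[of i] that by (simp add: nth_append)
      then have "?v \<in> (\<Pi>\<^sub>E i\<in>{..<?m}. carrier (pspace (Proj (xs ! i)) x))"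
        by simp
      then obtain a where a: "a \<in> carrier (pspace M x)" "\<phi> x a = ?v"
        using \<phi>_bij[of x] unfolding bij_betw_def by (metis imageE)
      have "v (?m + i) \<in> carrier (pspace (Proj (ys ! i)) x)" if "i < ?n" for i
        using v_in[of "?m + i"] that by (simp add: nth_append)
      then have "?w \<in> (\<Pi>\<^sub>E i\<in>{..<?n}. carrier (pspace (Proj (ys ! i)) x))"
        by simp
      then obtain b where b: "b \<in> carrier (pspace N x)" "\<psi> x b = ?w"
        using \<psi>_bij[of x] unfolding bij_betw_def by (metis imageE)
      \<comment> \<open>Outside the concatenated range both sides are \<open>undefined\<close>, by
        extensionality.\<close>
      have "\<chi> x (a, b) i = v i" for i
        using v a(2) b(2) by (auto simp: \<chi>_def PiE_iff extensional_def)
      then show "v \<in> \<chi> x ` carrier (pspace (M \<oplus>\<^sub>p N) x)"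
        using a(1) b(1) by (intro image_eqI[of _ _ "(a, b)"]) auto
    qed
  qed
  \<comment> \<open>Viewing \<open>?S\<close> as the image of \<chi> also yields that
    \<open>?S\<close> is a persistence module.\<close>
  have "pmod_hom (M \<oplus>\<^sub>p N) ?S \<chi>"
  proof (rule persistence_module_image[OF sum])
    show "\<chi> x ` carrier (pspace (M \<oplus>\<^sub>p N) x) = carrier (pspace ?S x)" for x
      using bij[of x] by (simp add: bij_betw_def)
    show "\<chi> x \<zero>\<^bsub>pspace (M \<oplus>\<^sub>p N) x\<^esub> = \<zero>\<^bsub>pspace ?S x\<^esub>" for x
      using \<phi>D(5)[of x] \<psi>D(5)[of x] by (auto simp: \<chi>_def fun_eq_iff nth_append)
  qed (use \<phi>D(6-8) \<psi>D(6-8) in \<open>auto simp: \<chi>_def fun_eq_iff nth_append\<close>)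
  then show ?thesis
    using sum bij unfolding projective_def pmod_iso_def by blast
qed

section \<open>Quotients and homology\<close>

text \<open>Makes the theory of additive cosets available. Closure under negation is automatic in
  characteristic two.\<close>

lemma F2_submodule_abelian_subgroup:
  assumes V: "vectorspace F2 V" and W: "submodule F2 W V"
  shows "abelian_subgroup W V"
proof -
  interpret V: vectorspace F2 V by (rule V)
  interpret W: submodule F2 W V by (rule W)
  have "subgroup W (add_monoid V)"
  proof
    fix w assume w: "w \<in> W"
    then have "w \<in> carrier V" using W.subset by blast
    then have "\<ominus>\<^bsub>V\<^esub> w = w"
      using F2_add_self[OF V] V.minus_equality by blast
    then show "inv\<^bsub>add_monoid V\<^esub> w \<in> W"
      using w by (simp add: a_inv_def)
  qed (use W.subset in auto)
  then show ?thesis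
    by (simp add: V.abelian_group_axioms abelian_subgroupI3 additive_subgroup.intro)
qed

text \<open>A difference is a sum in characteristic two, and adding \<open>v\<close> a second time
  cancels the first.\<close>

lemma F2_mem_coset_iff:
  assumes V: "vectorspace F2 V" and W: "submodule F2 W V" and v: "v \<in> carrier V"
  shows "u \<in> W +>\<^bsub>V\<^esub> v \<longleftrightarrow> u \<in> carrier V \<and> u \<oplus>\<^bsub>V\<^esub> v \<in> W"
proof -
  interpret V: vectorspace F2 V by (rule V)
  interpret W: submodule F2 W V by (rule W)
  have "w \<oplus>\<^bsub>V\<^esub> v \<oplus>\<^bsub>V\<^esub> v = w" if "w \<in> carrier V" for w
    using that v by (simp add: V.a_assoc F2_add_self[OF V])
  then show ?thesis
    using v W.subset by (force simp: a_r_coset_def')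
qed

lemma F2_coset_eq_iff:
  assumes V: "vectorspace F2 V" and W: "submodule F2 W V"
    and u: "u \<in> carrier V" and v: "v \<in> carrier V"
  shows "W +>\<^bsub>V\<^esub> u = W +>\<^bsub>V\<^esub> v \<longleftrightarrow> u \<oplus>\<^bsub>V\<^esub> v \<in> W"
proof -
  interpret abelian_subgroup W V by (rule F2_submodule_abelian_subgroup[OF V W])
  show ?thesis
    using F2_mem_coset_iff[OF V W] u v a_rcos_self a_repr_independence' by metis
qed

text \<open>Scalar multiplication and structure maps of a quotient are defined as unions over
  representatives. When the value does not depend on the representative, the union over the nonempty
  coset collapses to that value.\<close>

lemma F2_UN_coset:
  assumes V: "vectorspace F2 V" and W: "submodule F2 W V" and v: "v \<in> carrier V"
    and "\<And>u. u \<in> carrier V \<Longrightarrow> u \<oplus>\<^bsub>V\<^esub> v \<in> W \<Longrightarrow> h u = h v"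
  shows "(\<Union>u \<in> W +>\<^bsub>V\<^esub> v. h u) = h v"
proof -
  interpret abelian_subgroup W V by (rule F2_submodule_abelian_subgroup[OF V W])
  show ?thesis
    using assms(4) a_rcos_self[OF v] F2_mem_coset_iff[OF V W v] by blast
qed

section \<open>Submodules and quotient modules\<close>

lemma persistence_module_sub:
  assumes M: "persistence_module M"
    and U: "\<And>x. submodule F2 (U x) (pspace M x)"
    and stable: "\<And>x y v. x \<le> y \<Longrightarrow> v \<in> U x \<Longrightarrow> pmap M x y v \<in> U y"
  shows "persistence_module (sub_pmod M U)"
proof -
  note D = persistence_moduleD[OF M]
  have sub: "v \<in> carrier (pspace M x)" if "v \<in> U x" for v x
    using submodule.subset[OF U] that by blast
  have vs: "vectorspace F2 (pspace (sub_pmod M U) x)" for x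
    using vectorspace.subspace_is_vs[OF D(1)[of x]] U D(1) by (simp add: subspace_def sub_pmod_def)
  show ?thesis
  proof (rule persistence_moduleI[OF vs])
    show "finite (carrier (pspace (sub_pmod M U) x))" for x
      using D(2) sub by (auto simp: sub_pmod_def intro: finite_subset)
    show "linear_map F2 (pspace (sub_pmod M U) x) (pspace (sub_pmod M U) y) (pmap (sub_pmod M U) x y)"
      if le: "x \<le> y" for x y
    proof -
      interpret linear_map F2 "pspace M x" "pspace M y" "pmap M x y" by (rule D(3)[OF le])
      show ?thesis
        by (rule linear_mapI[OF vs vs]) (use stable[OF le] sub in \<open>simp_all add: sub_pmod_def\<close>)
    qed
  qed (use D sub in \<open>simp_all add: sub_pmod_def\<close>)
qed

text \<open>The projection is onto by construction, so the quotient inherits its structure from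
  \<open>M\<close>. What has to be shown for scalars and structure maps is independence of
  representatives: \<open>W x\<close> is closed under scalars, and \<open>stable\<close> handles the
  structure maps.\<close>

lemma pmod_hom_quotient:
  assumes M: "persistence_module M"
    and W: "\<And>x. submodule F2 (W x) (pspace M x)"
    and stable: "\<And>x y v. x \<le> y \<Longrightarrow> v \<in> W x \<Longrightarrow> pmap M x y v \<in> W y"
  shows "pmod_hom M (quotient_pmod M W) (\<lambda>x v. W x +>\<^bsub>pspace M x\<^esub> v)"
proof (rule persistence_module_image[OF M])
  note D = persistence_moduleD[OF M] and S = pmod_spaceD[OF M]
  fix x
  interpret V: vectorspace F2 "pspace M x" by (rule D)
  interpret abelian_subgroup "W x" "pspace M x"
    by (rule F2_submodule_abelian_subgroup[OF D(1) W])
  show "(\<lambda>v. W x +>\<^bsub>pspace M x\<^esub> v) ` carrier (pspace M x) =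
      carrier (pspace (quotient_pmod M W) x)"
    by (auto simp: quotient_pmod_def quotient_space_def A_RCOSETS_def')
  show "W x +>\<^bsub>pspace M x\<^esub> \<zero>\<^bsub>pspace M x\<^esub> = \<zero>\<^bsub>pspace (quotient_pmod M W) x\<^esub>"
    using submodule.subset[OF W] by (simp add: quotient_pmod_def quotient_space_def)
  fix v assume v: "v \<in> carrier (pspace M x)"
  show "W x +>\<^bsub>pspace M x\<^esub> (v \<oplus>\<^bsub>pspace M x\<^esub> w) =
      (W x +>\<^bsub>pspace M x\<^esub> v) \<oplus>\<^bsub>pspace (quotient_pmod M W) x\<^esub> (W x +>\<^bsub>pspace M x\<^esub> w)"
    if "w \<in> carrier (pspace M x)" for w
    using v that by (simp add: quotient_pmod_def quotient_space_def a_rcos_sum)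
  show "W x +>\<^bsub>pspace M x\<^esub> (c \<odot>\<^bsub>pspace M x\<^esub> v) =
      c \<odot>\<^bsub>pspace (quotient_pmod M W) x\<^esub> (W x +>\<^bsub>pspace M x\<^esub> v)" for c
  proof -
    have "W x +>\<^bsub>pspace M x\<^esub> (c \<odot>\<^bsub>pspace M x\<^esub> u) = W x +>\<^bsub>pspace M x\<^esub> (c \<odot>\<^bsub>pspace M x\<^esub> v)"
      if "u \<in> carrier (pspace M x)" "u \<oplus>\<^bsub>pspace M x\<^esub> v \<in> W x" for u
      using that v submodule.smult_closed[OF W, of c]
      by (simp add: F2_coset_eq_iff[OF D(1) W] flip: V.smult_r_distr)
    from F2_UN_coset[OF D(1) W v, of "\<lambda>u. W x +>\<^bsub>pspace M x\<^esub> (c \<odot>\<^bsub>pspace M x\<^esub> u)", OF this]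
    show ?thesis
      by (simp add: quotient_pmod_def quotient_space_def)
  qed
  fix y assume le: "x \<le> y"
  interpret f: linear_map F2 "pspace M x" "pspace M y" "pmap M x y" by (rule D(3)[OF le])
  have "W y +>\<^bsub>pspace M y\<^esub> pmap M x y u = W y +>\<^bsub>pspace M y\<^esub> pmap M x y v"
    if "u \<in> carrier (pspace M x)" "u \<oplus>\<^bsub>pspace M x\<^esub> v \<in> W x" for u
    using that v stable[OF le] by (simp add: F2_coset_eq_iff[OF D(1) W] flip: f.T_add)
  from F2_UN_coset[OF D(1) W v, of "\<lambda>u. W y +>\<^bsub>pspace M y\<^esub> pmap M x y u", OF this]
  show "W y +>\<^bsub>pspace M y\<^esub> pmap M x y v =
      pmap (quotient_pmod M W) x y (W x +>\<^bsub>pspace M x\<^esub> v)"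
    by (simp add: quotient_pmod_def)
qed

lemma quotient_pmod_carrier:
  "carrier (pspace (quotient_pmod M W) x) = (\<lambda>v. W x +>\<^bsub>pspace M x\<^esub> v) ` carrier (pspace M x)"
  by (auto simp: quotient_pmod_def quotient_space_def A_RCOSETS_def')

text \<open>Cosets of the kernel are exactly the fibres of \<phi>, so \<phi> induces an injective
  map on them, which is onto because \<phi> is.\<close>

lemma pmod_first_isomorphism:
  assumes \<phi>: "pmod_hom M N \<phi>"
    and surj: "\<And>x. \<phi> x ` carrier (pspace M x) = carrier (pspace N x)"
  shows "pmod_iso (quotient_pmod M (pker M N \<phi>)) N"
proof -
  note D = pmod_homD[OF \<phi>]
  note M = persistence_moduleD[OF D(1)] pmod_spaceD[OF D(1)]
  let ?W = "pker M N \<phi>"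
  have W: "submodule F2 (?W x) (pspace M x)" for x
    by (rule pker_submodule[OF \<phi>])
  have q: "pmod_hom M (quotient_pmod M ?W) (\<lambda>x v. ?W x +>\<^bsub>pspace M x\<^esub> v)"
    by (intro pmod_hom_quotient D W pmap_pker[OF \<phi>])
  have mem: "u \<oplus>\<^bsub>pspace M x\<^esub> v \<in> ?W x \<longleftrightarrow> \<phi> x u = \<phi> x v"
    if "u \<in> carrier (pspace M x)" "v \<in> carrier (pspace M x)" for x u v
    using that D(4,6) M(8) pmod_spaceD(4)[OF D(2)] by (simp add: pker_eq[OF \<phi>])
  \<comment> \<open>Since \<phi> is constant on a coset, the image of the coset is a singleton, and
    \<open>the_elem\<close> reads off its element without a choice of representative.\<close>
  define \<psi> where "\<psi> x X = the_elem (\<phi> x ` X)" for x X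
  have \<psi>: "\<psi> x (?W x +>\<^bsub>pspace M x\<^esub> v) = \<phi> x v" if v: "v \<in> carrier (pspace M x)" for x v
  proof -
    have "\<phi> x u = \<phi> x v" if "u \<in> ?W x +>\<^bsub>pspace M x\<^esub> v" for u
      using that mem v F2_mem_coset_iff[OF M(1) W v] by blast
    moreover have "v \<in> ?W x +>\<^bsub>pspace M x\<^esub> v"
      using v mem by (simp add: F2_mem_coset_iff[OF M(1) W])
    ultimately have "\<phi> x ` (?W x +>\<^bsub>pspace M x\<^esub> v) = {\<phi> x v}" by blast
    then show ?thesis by (simp add: \<psi>_def)
  qed
  \<comment> \<open>Descent along the projection transfers linearity and naturality from
    \<phi>.\<close>
  have "pmod_hom (quotient_pmod M ?W) N \<psi>"
    by (rule pmod_hom_descend[OF q \<phi>]) (simp_all add: quotient_pmod_carrier \<psi>)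
  moreover have "bij_betw (\<psi> x) (carrier (pspace (quotient_pmod M ?W) x)) (carrier (pspace N x))" for x
  proof (rule bij_betw_imageI)
    show "inj_on (\<psi> x) (carrier (pspace (quotient_pmod M ?W) x))"
      using mem by (auto simp: inj_on_def quotient_pmod_carrier \<psi> F2_coset_eq_iff[OF M(1) W])
    show "\<psi> x ` carrier (pspace (quotient_pmod M ?W) x) = carrier (pspace N x)"
      by (simp add: quotient_pmod_carrier image_image \<psi> surj[symmetric] cong: image_cong)
  qed
  ultimately show ?thesis
    unfolding pmod_iso_def by blast
qed

section \<open>Isomorphisms between homology modules\<close>

lemma persistence_module_pker:
  assumes d: "pmod_hom B A d"
  shows "persistence_module (sub_pmod B (pker B A d))"
  by (intro persistence_module_sub[OF pmod_homD(1)[OF d]] pker_submodule[OF d] pmap_pker[OF d])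

text \<open>As \<open>sub_pmod\<close> changes the carrier only, the closure properties of the image
  persist; \<open>dd\<close> places the image inside the kernel.\<close>

lemma homology_submodule:
  assumes d: "pmod_hom B A d" and d': "pmod_hom C B d'"
    and dd: "\<And>x c. c \<in> carrier (pspace C x) \<Longrightarrow> d x (d' x c) = \<zero>\<^bsub>pspace A x\<^esub>"
  shows "submodule F2 (pim C d' x) (pspace (sub_pmod B (pker B A d)) x)"
  using pim_submodule[OF d', of x] persistence_moduleD(1)[OF persistence_module_pker[OF d], of x]
    dd pmod_homD(4)[OF d']
  by (auto simp: submodule_def sub_pmod_def vectorspace_def pim_eq[OF d'] pker_eq[OF d])

lemma pmod_hom_homology:
  assumes d: "pmod_hom B A d" and d': "pmod_hom C B d'"
    and dd: "\<And>x c. c \<in> carrier (pspace C x) \<Longrightarrow> d x (d' x c) = \<zero>\<^bsub>pspace A x\<^esub>"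
  shows "pmod_hom (sub_pmod B (pker B A d)) (homology A d B d' C)
    (\<lambda>x v. pim C d' x +>\<^bsub>pspace (sub_pmod B (pker B A d)) x\<^esub> v)"
  unfolding homology_def
proof (rule pmod_hom_quotient[OF persistence_module_pker[OF d]])
  note D' = pmod_homD[OF d']
  show "submodule F2 (pim C d' x) (pspace (sub_pmod B (pker B A d)) x)" for x
    by (rule homology_submodule[OF d d' dd])
  \<comment> \<open>Naturality of \<open>d'\<close> writes a transported boundary as
    \<open>d'\<close> of a transported chain.\<close>
  show "pmap (sub_pmod B (pker B A d)) x y v \<in> pim C d' y" if "x \<le> y" "v \<in> pim C d' x" for x y v
    using that D'(8) persistence_moduleD(4)[OF D'(1)]
    by (auto simp: pim_eq[OF d'] sub_pmod_def simp flip: D'(8))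
qed

text \<open>By \<open>cycle\<close>, \<phi> restricts to cycles; followed by the projection to the
  target homology it is onto by \<open>surj\<close>. By \<open>boundary\<close> its kernel consists
  of the source boundaries, so the first isomorphism theorem applies.\<close>

lemma homology_iso:
  assumes d: "pmod_hom B A d" and d': "pmod_hom C B d'"
    and dd: "\<And>x c. c \<in> carrier (pspace C x) \<Longrightarrow> d x (d' x c) = \<zero>\<^bsub>pspace A x\<^esub>"
    and e: "pmod_hom B' A' e" and e': "pmod_hom C' B' e'"
    and ee: "\<And>x c. c \<in> carrier (pspace C' x) \<Longrightarrow> e x (e' x c) = \<zero>\<^bsub>pspace A' x\<^esub>"
    and \<phi>: "pmod_hom B B' \<phi>"
    and cycle: "\<And>x v. v \<in> carrier (pspace B x) \<Longrightarrow> d x v = \<zero>\<^bsub>pspace A x\<^esub> \<Longrightarrow>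
      e x (\<phi> x v) = \<zero>\<^bsub>pspace A' x\<^esub>"
    and surj: "\<And>x w. w \<in> carrier (pspace B' x) \<Longrightarrow> e x w = \<zero>\<^bsub>pspace A' x\<^esub> \<Longrightarrow>
      \<exists>v\<in>carrier (pspace B x). d x v = \<zero>\<^bsub>pspace A x\<^esub> \<and> \<phi> x v = w"
    and boundary: "\<And>x v. v \<in> carrier (pspace B x) \<Longrightarrow> d x v = \<zero>\<^bsub>pspace A x\<^esub> \<Longrightarrow>
      \<phi> x v \<in> e' x ` carrier (pspace C' x) \<longleftrightarrow> v \<in> d' x ` carrier (pspace C x)"
  shows "pmod_iso (homology A d B d' C) (homology A' e B' e' C')"
proof -
  let ?Z = "sub_pmod B (pker B A d)" and ?Z' = "sub_pmod B' (pker B' A' e)"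
  let ?H' = "homology A' e B' e' C'"
  have Z: "carrier (pspace ?Z x) = {v \<in> carrier (pspace B x). d x v = \<zero>\<^bsub>pspace A x\<^esub>}" for x
    by (simp add: sub_pmod_def pker_eq[OF d])
  have Z': "carrier (pspace ?Z' x) = {v \<in> carrier (pspace B' x). e x v = \<zero>\<^bsub>pspace A' x\<^esub>}" for x
    by (simp add: sub_pmod_def pker_eq[OF e])
  note \<phi>D = pmod_homD[OF \<phi>]
  have "pmod_hom ?Z ?Z' \<phi>"
  proof (rule pmod_homI)
    show "persistence_module ?Z" by (rule persistence_module_pker[OF d])
    show "persistence_module ?Z'" by (rule persistence_module_pker[OF e])
    show "\<phi> x v \<in> carrier (pspace ?Z' x)" if "v \<in> carrier (pspace ?Z x)" for x v
      using that cycle \<phi>D(4) by (simp add: Z Z')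
  qed (use \<phi>D(6-8) in \<open>simp_all add: Z\<close>, use \<phi>D(6-8) in \<open>simp_all add: sub_pmod_def\<close>)
  from pmod_hom_compose[OF this pmod_hom_homology[OF e e' ee]]
  have hom: "pmod_hom ?Z ?H' (\<lambda>x v. pim C' e' x +>\<^bsub>pspace ?Z' x\<^esub> \<phi> x v)"
    (is "pmod_hom _ _ ?\<psi>") .
  have vs': "vectorspace F2 (pspace ?Z' x)" for x
    by (rule persistence_moduleD(1)[OF persistence_module_pker[OF e]])
  have sub': "submodule F2 (pim C' e' x) (pspace ?Z' x)" for x
    by (rule homology_submodule[OF e e' ee])
  have "?\<psi> x ` carrier (pspace ?Z x) = carrier (pspace ?H' x)" for x
  proof -
    have "\<phi> x ` carrier (pspace ?Z x) = carrier (pspace ?Z' x)"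
    proof (intro equalityI subsetI)
      show "w \<in> carrier (pspace ?Z' x)" if "w \<in> \<phi> x ` carrier (pspace ?Z x)" for w
        using that cycle \<phi>D(4) unfolding Z Z' by blast
      show "w \<in> \<phi> x ` carrier (pspace ?Z x)" if "w \<in> carrier (pspace ?Z' x)" for w
        using that surj[of w x] unfolding Z Z' by blast
    qed
    then show ?thesis
      unfolding homology_def quotient_pmod_carrier by (metis image_image)
  qed
  note iso = pmod_first_isomorphism[OF hom this]
  \<comment> \<open>Identifying this kernel with the source boundaries turns the quotient in
    \<open>iso\<close> into the source homology.\<close>
  have "pker ?Z ?H' ?\<psi> x = pim C d' x" for x
  proof -
    interpret abelian_subgroup "pim C' e' x" "pspace ?Z' x"
      by (rule F2_submodule_abelian_subgroup[OF vs' sub'])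
    \<comment> \<open>The zero of the quotient is the subgroup itself, and a coset equals it exactly
      when its representative lies in the subgroup.\<close>
    have \<psi>0: "?\<psi> x v = \<zero>\<^bsub>pspace ?H' x\<^esub> \<longleftrightarrow> \<phi> x v \<in> pim C' e' x" if "v \<in> carrier (pspace ?Z x)" for v
    proof -
      have "\<phi> x v \<in> carrier (pspace ?Z' x)"
        using that cycle \<phi>D(4) by (simp add: Z Z')
      then show ?thesis
        using a_rcos_const a_rcos_self
        by (auto simp: homology_def quotient_pmod_def quotient_space_def)
    qed
    \<comment> \<open>Kernel elements are cycles by definition, so equality of the two sets also
      requires boundaries to be cycles.\<close>
    have bdry: "v \<in> carrier (pspace ?Z x)" if "v \<in> pim C d' x" for v
      using that dd pmod_homD(4)[OF d'] by (auto simp: Z pim_eq[OF d'])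
    have "\<phi> x v \<in> pim C' e' x \<longleftrightarrow> v \<in> pim C d' x" if "v \<in> carrier (pspace ?Z x)" for v
      unfolding pim_eq[OF d'] pim_eq[OF e'] using that boundary[of v x] by (simp add: Z)
    then show ?thesis
      unfolding pker_eq[OF hom] using \<psi>0 bdry by blast
  qed
  then have "pker ?Z ?H' ?\<psi> = pim C d'" by blast
  with iso show ?thesis by (simp add: homology_def)
qed



section \<open>The projective implicit representation for a poset tower\<close>

theorem theorem22:
  fixes K :: "('p::{finite,order}, 'v) tower"
    and l :: int
    and G :: "int \<Rightarrow> ('p, 'g) pmod"
    and R :: "int \<Rightarrow> ('p, 'r) pmod"
    and RR :: "int \<Rightarrow> ('p, 's) pmod"
    and \<alpha> :: "int \<Rightarrow> 'p \<Rightarrow> 'g \<Rightarrow> ('v set \<Rightarrow> bit)"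
    and p1 :: "int \<Rightarrow> 'p \<Rightarrow> 'r \<Rightarrow> 'g"
    and p2 :: "int \<Rightarrow> 'p \<Rightarrow> 's \<Rightarrow> 'r"
    and f0 :: "int \<Rightarrow> 'p \<Rightarrow> 'g \<Rightarrow> 'g"
    and f1 :: "int \<Rightarrow> 'p \<Rightarrow> 'r \<Rightarrow> 'r"
    and \<theta> :: "'p \<Rightarrow> 'g \<Rightarrow> 'r"
  assumes tower: "poset_tower K"
    and resolution: "\<And>k. k \<in> {l - 1, l, l + 1} \<Longrightarrow>
      projective_resolution2 (chain_pmod k K) (\<alpha> k) (G k) (p1 k) (R k) (p2 k) (RR k)"
    and f0_hom: "\<And>k. k \<in> {l, l + 1} \<Longrightarrow> pmod_hom (G k) (G (k - 1)) (f0 k)"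
    and f0_lift: "\<And>k x v. k \<in> {l, l + 1} \<Longrightarrow> v \<in> carrier (pspace (G k) x) \<Longrightarrow>
      \<alpha> (k - 1) x (f0 k x v) = boundary K k x (\<alpha> k x v)"
    and f1_hom: "\<And>k. k \<in> {l, l + 1} \<Longrightarrow> pmod_hom (R k) (R (k - 1)) (f1 k)"
    and f1_lift: "\<And>k x v. k \<in> {l, l + 1} \<Longrightarrow> v \<in> carrier (pspace (R k) x) \<Longrightarrow>
      p1 (k - 1) x (f1 k x v) = f0 k x (p1 k x v)"
    and \<theta>_hom: "pmod_hom (G (l + 1)) (R (l - 1)) \<theta>"
    and \<theta>_lift: "\<And>x v. v \<in> carrier (pspace (G (l + 1)) x) \<Longrightarrow>
      p1 (l - 1) x (\<theta> x v) = f0 l x (f0 (l + 1) x v)"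
  shows "projective_implicit_rep
    (homology (chain_pmod (l - 1) K) (boundary K l) (chain_pmod l K)
       (boundary K (l + 1)) (chain_pmod (l + 1) K))
    (G (l - 1))
    (\<lambda>x (g, r). f0 l x g \<oplus>\<^bsub>pspace (G (l - 1)) x\<^esub> p1 (l - 1) x r)
    (G l \<oplus>\<^sub>p R (l - 1))
    (\<lambda>x (g, r, s).
       (f0 (l + 1) x g \<oplus>\<^bsub>pspace (G l) x\<^esub> p1 l x r,
        \<theta> x g \<oplus>\<^bsub>pspace (R (l - 1)) x\<^esub> f1 l x r \<oplus>\<^bsub>pspace (R (l - 1)) x\<^esub> p2 (l - 1) x s))
    (G (l + 1) \<oplus>\<^sub>p R l \<oplus>\<^sub>p RR (l - 1))"
proof -
  let ?C = "\<lambda>k. chain_pmod k K" and ?d = "boundary K"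
  have res: "projective_resolution2 (?C k) (\<alpha> k) (G k) (p1 k) (R k) (p2 k) (RR k)"
    if "k \<in> {l - 1, l, l + 1}" for k
    using resolution that .
  \<comment> \<open>The resolutions are unpacked with exactness as a criterion for single elements,
    the form used in the diagram chases.\<close>
  have \<alpha>: "pmod_hom (G k) (?C k) (\<alpha> k)" and p1: "pmod_hom (R k) (G k) (p1 k)"
    and p2: "pmod_hom (RR k) (R k) (p2 k)"
    and proj: "projective (G k)" "projective (R k)" "projective (RR k)"
    and \<alpha>_surj: "\<And>x. \<alpha> k x ` carrier (pspace (G k) x) = carrier (pspace (?C k) x)"
    and \<alpha>_exact: "\<And>x v. v \<in> carrier (pspace (G k) x) \<Longrightarrow>
      \<alpha> k x v = \<zero>\<^bsub>pspace (?C k) x\<^esub> \<longleftrightarrow> v \<in> p1 k x ` carrier (pspace (R k) x)"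
    and p1_exact: "\<And>x v. v \<in> carrier (pspace (R k) x) \<Longrightarrow>
      p1 k x v = \<zero>\<^bsub>pspace (G k) x\<^esub> \<longleftrightarrow> v \<in> p2 k x ` carrier (pspace (RR k) x)"
    if k: "k \<in> {l - 1, l, l + 1}" for k
  proof -
    show \<alpha>: "pmod_hom (G k) (?C k) (\<alpha> k)" and p1: "pmod_hom (R k) (G k) (p1 k)"
      and p2: "pmod_hom (RR k) (R k) (p2 k)"
      and "projective (G k)" "projective (R k)" "projective (RR k)"
      using res[OF k] by (simp_all add: projective_resolution2_def)
    have "pim (G k) (\<alpha> k) x = carrier (pspace (?C k) x)"
      "pker (G k) (?C k) (\<alpha> k) x = pim (R k) (p1 k) x"
      "pker (R k) (G k) (p1 k) x = pim (RR k) (p2 k) x" for x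
      using res[OF k] by (simp_all add: projective_resolution2_def)
    note this[unfolded pim_eq[OF \<alpha>] pim_eq[OF p1] pim_eq[OF p2] pker_eq[OF \<alpha>] pker_eq[OF p1]]
    then show "\<alpha> k x ` carrier (pspace (G k) x) = carrier (pspace (?C k) x)"
      "v \<in> carrier (pspace (G k) x) \<Longrightarrow>
        \<alpha> k x v = \<zero>\<^bsub>pspace (?C k) x\<^esub> \<longleftrightarrow> v \<in> p1 k x ` carrier (pspace (R k) x)"
      "w \<in> carrier (pspace (R k) x) \<Longrightarrow>
        p1 k x w = \<zero>\<^bsub>pspace (G k) x\<^esub> \<longleftrightarrow> w \<in> p2 k x ` carrier (pspace (RR k) x)"
      for x v w
      by blast+
  qed
  have f0: "pmod_hom (G l) (G (l - 1)) (f0 l)" "pmod_hom (G (l + 1)) (G l) (f0 (l + 1))"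
    using f0_hom[of l] f0_hom[of "l + 1"] by simp_all
  have f1: "pmod_hom (R l) (R (l - 1)) (f1 l)"
    using f1_hom[of l] by simp
  \<comment> \<open>On the values of \<open>\<alpha> l\<close> the boundary is
    \<open>\<alpha> (l - 1)\<close> after \<open>f0 l\<close>, so it descends from this
    composite.\<close>
  have d: "pmod_hom (?C l) (?C (l - 1)) (?d l)"
    using pmod_hom_descend[OF \<alpha>[of l] pmod_hom_compose[OF f0(1) \<alpha>[of "l - 1"]] \<alpha>_surj[of l]]
      f0_lift[of l] by simp
  have d': "pmod_hom (?C (l + 1)) (?C l) (?d (l + 1))"
    using pmod_hom_descend[OF \<alpha>[of "l + 1"] pmod_hom_compose[OF f0(2) \<alpha>[of l]] \<alpha>_surj[of "l + 1"]]
      f0_lift[of "l + 1"] by simp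
  have \<alpha>_l: "pmod_hom (G l) (?C l) (\<alpha> l)" and p1_l: "pmod_hom (R l) (G l) (p1 l)"
    and p1_pred: "pmod_hom (R (l - 1)) (G (l - 1)) (p1 (l - 1))"
    and p2_pred: "pmod_hom (RR (l - 1)) (R (l - 1)) (p2 (l - 1))"
    using \<alpha> p1 p2 by simp_all
  note D = pmod_homD[OF f0(1)] pmod_homD[OF f0(2)] pmod_homD[OF f1] pmod_homD[OF \<alpha>_l]
    pmod_homD[OF p1_l] pmod_homD[OF p1_pred] pmod_homD[OF p2_pred] pmod_homD[OF \<theta>_hom]
  have pm: "persistence_module (G l)" "persistence_module (R l)" "persistence_module (G (l + 1))"
    "persistence_module (G (l - 1))" "persistence_module (R (l - 1))" "persistence_module (RR (l - 1))"
    "persistence_module (?C l)"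
    by (rule D)+
  let ?B = "G l \<oplus>\<^sub>p R (l - 1)" and ?E = "G (l + 1) \<oplus>\<^sub>p R l \<oplus>\<^sub>p RR (l - 1)"
  \<comment> \<open>Using \<open>fst\<close> and \<open>snd\<close> in place of the tuple patterns
    of the statement makes the entries match composites with the projection morphisms. Triples are
    nested to the right.\<close>
  define dc where "dc x v = f0 l x (fst v) \<oplus>\<^bsub>pspace (G (l - 1)) x\<^esub> p1 (l - 1) x (snd v)" for x v
  define dr where "dr x v =
    (f0 (l + 1) x (fst v) \<oplus>\<^bsub>pspace (G l) x\<^esub> p1 l x (fst (snd v)),
     \<theta> x (fst v) \<oplus>\<^bsub>pspace (R (l - 1)) x\<^esub> f1 l x (fst (snd v))
       \<oplus>\<^bsub>pspace (R (l - 1)) x\<^esub> p2 (l - 1) x (snd (snd v)))" for x v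
  have pmE: "persistence_module (R l \<oplus>\<^sub>p RR (l - 1))"
    by (intro persistence_module_sum pm)
  have dc: "pmod_hom ?B (G (l - 1)) dc"
    unfolding dc_def
    by (intro pmod_hom_add pmod_hom_compose[OF pmod_hom_fst f0(1)]
        pmod_hom_compose[OF pmod_hom_snd p1_pred] pm)
  have dr: "pmod_hom ?E ?B dr"
    unfolding dr_def
    by (intro pmod_hom_pair pmod_hom_add pmod_hom_compose[OF pmod_hom_fst f0(2)]
        pmod_hom_compose[OF pmod_hom_fst \<theta>_hom]
        pmod_hom_compose[OF pmod_hom_compose[OF pmod_hom_snd pmod_hom_fst] p1_l]
        pmod_hom_compose[OF pmod_hom_compose[OF pmod_hom_snd pmod_hom_fst] f1]
        pmod_hom_compose[OF pmod_hom_compose[OF pmod_hom_snd pmod_hom_snd] p2_pred] pm pmE)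
  have p1p2: "p1 (l - 1) x (p2 (l - 1) x s) = \<zero>\<^bsub>pspace (G (l - 1)) x\<^esub>"
    if "s \<in> carrier (pspace (RR (l - 1)) x)" for x s
    using p1_exact[of "l - 1" "p2 (l - 1) x s" x] that D by simp
  have \<alpha>p1: "\<alpha> l x (p1 l x r) = \<zero>\<^bsub>pspace (?C l) x\<^esub>" if "r \<in> carrier (pspace (R l) x)" for x r
    using \<alpha>_exact[of l "p1 l x r" x] that D by simp
  have f1_l: "p1 (l - 1) x (f1 l x r) = f0 l x (p1 l x r)" if "r \<in> carrier (pspace (R l) x)" for x r
    using f1_lift[of l] that by simp
  \<comment> \<open>After applying \<open>p1\<close>, the lifting conditions for \<theta> and
    \<open>f1\<close> turn the second row without its \<open>p2\<close> entry into
    \<open>f0 l\<close> of the first row. This identity is behind both \<open>dcdr\<close> and the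
    comparison of boundaries.\<close>
  have p1_corner: "p1 (l - 1) x (\<theta> x g \<oplus>\<^bsub>pspace (R (l - 1)) x\<^esub> f1 l x r) =
      f0 l x (f0 (l + 1) x g \<oplus>\<^bsub>pspace (G l) x\<^esub> p1 l x r)"
    if "g \<in> carrier (pspace (G (l + 1)) x)" "r \<in> carrier (pspace (R l) x)" for x g r
    using that D by (simp add: \<theta>_lift f1_l)
  have dcdr: "dc x (dr x v) = \<zero>\<^bsub>pspace (G (l - 1)) x\<^esub>" if v_in: "v \<in> carrier (pspace ?E x)" for x v
  proof -
    interpret V: vectorspace F2 "pspace (G (l - 1)) x" by (rule persistence_moduleD(1)[OF pm(4)])
    obtain g r s where v: "v = (g, r, s)" "g \<in> carrier (pspace (G (l + 1)) x)"
      "r \<in> carrier (pspace (R l) x)" "s \<in> carrier (pspace (RR (l - 1)) x)"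
      using v_in by auto
    let ?u = "\<theta> x g \<oplus>\<^bsub>pspace (R (l - 1)) x\<^esub> f1 l x r"
    let ?b = "f0 (l + 1) x g \<oplus>\<^bsub>pspace (G l) x\<^esub> p1 l x r"
    have b: "?b \<in> carrier (pspace (G l) x)" and u: "?u \<in> carrier (pspace (R (l - 1)) x)"
      using v D pmod_spaceD(2)[OF pm(1)] pmod_spaceD(2)[OF pm(5)] by simp_all
    \<comment> \<open>The \<open>p2\<close> entry dies under \<open>p1\<close>, so both summands of
      \<open>dc\<close> become \<open>f0 l x ?b\<close> and cancel in characteristic two.\<close>
    have "p1 (l - 1) x (snd (dr x v)) = p1 (l - 1) x ?u \<oplus>\<^bsub>pspace (G (l - 1)) x\<^esub> p1 (l - 1) x (p2 (l - 1) x s)"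
      using v u D by (simp add: dr_def)
    also have "\<dots> = f0 l x ?b"
      unfolding p1_corner[OF v(2,3)] p1p2[OF v(4)] using b D by simp
    finally have "dc x (dr x v) = f0 l x ?b \<oplus>\<^bsub>pspace (G (l - 1)) x\<^esub> f0 l x ?b"
      unfolding dc_def using v(1) by (simp add: dr_def)
    then show ?thesis
      using pmod_spaceD(4)[OF pm(4)] D(4)[OF b] by simp
  qed
  have dd: "?d l x (?d (l + 1) x c) = \<zero>\<^bsub>pspace (?C (l - 1)) x\<^esub>"
    if c: "c \<in> carrier (pspace (?C (l + 1)) x)" for x c
  proof -
    obtain h where h: "h \<in> carrier (pspace (G (l + 1)) x)" "c = \<alpha> (l + 1) x h"
      using c \<alpha>_surj[of "l + 1" x] by auto
    \<comment> \<open>Through \<theta>, the composite of the two lifts \<open>f0\<close> lands in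
      the image of \<open>p1\<close>, which \<alpha> kills.\<close>
    have "?d l x (?d (l + 1) x c) = \<alpha> (l - 1) x (f0 l x (f0 (l + 1) x h))"
      using h D f0_lift[of l "f0 (l + 1) x h" x] f0_lift[of "l + 1" h x] by simp
    also have "\<dots> = \<alpha> (l - 1) x (p1 (l - 1) x (\<theta> x h))"
      using h \<theta>_lift by simp
    also have "\<dots> = \<zero>\<^bsub>pspace (?C (l - 1)) x\<^esub>"
      using h D \<alpha>_exact[of "l - 1" "p1 (l - 1) x (\<theta> x h)" x] by simp
    finally show ?thesis .
  qed
  have dc_zero: "dc x (g, r) = \<zero>\<^bsub>pspace (G (l - 1)) x\<^esub> \<longleftrightarrow> f0 l x g = p1 (l - 1) x r"
    if "g \<in> carrier (pspace (G l) x)" "r \<in> carrier (pspace (R (l - 1)) x)" for x g r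
    using that D pmod_spaceD(4)[OF pm(4)] by (simp add: dc_def)
  have iso: "pmod_iso (homology (G (l - 1)) dc ?B dr ?E)
    (homology (?C (l - 1)) (?d l) (?C l) (?d (l + 1)) (?C (l + 1)))"
  proof (rule homology_iso[OF dc dr dcdr d d' dd pmod_hom_compose[OF pmod_hom_fst \<alpha>_l]])
    \<comment> \<open>One block settles two goals, as both concern a cycle \<open>v\<close>: its
      image is a cycle, and \<open>v\<close> is a boundary exactly when its image is.\<close>
    fix x v assume "v \<in> carrier (pspace ?B x)" "dc x v = \<zero>\<^bsub>pspace (G (l - 1)) x\<^esub>"
    then obtain g r where v: "v = (g, r)" "g \<in> carrier (pspace (G l) x)"
      "r \<in> carrier (pspace (R (l - 1)) x)" "f0 l x g = p1 (l - 1) x r"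
      using dc_zero by auto
    show "?d l x (\<alpha> l x (fst v)) = \<zero>\<^bsub>pspace (?C (l - 1)) x\<^esub>"
      using v D \<alpha>_exact[of "l - 1" "p1 (l - 1) x r" x] f0_lift[of l g x] by simp
    show "\<alpha> l x (fst v) \<in> ?d (l + 1) x ` carrier (pspace (?C (l + 1)) x) \<longleftrightarrow>
        v \<in> dr x ` carrier (pspace ?E x)"
    proof
      assume "v \<in> dr x ` carrier (pspace ?E x)"
      then obtain h r' s where h: "h \<in> carrier (pspace (G (l + 1)) x)"
        "r' \<in> carrier (pspace (R l) x)" "g = f0 (l + 1) x h \<oplus>\<^bsub>pspace (G l) x\<^esub> p1 l x r'"
        using v(1) by (auto simp: dr_def)
      interpret V: vectorspace F2 "pspace (?C l) x" by (rule persistence_moduleD(1)[OF pm(7)])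
      have \<alpha>h: "\<alpha> (l + 1) x h \<in> carrier (pspace (?C (l + 1)) x)"
        using h(1) \<alpha>_surj[of "l + 1" x] by auto
      \<comment> \<open>Applying \<open>\<alpha> l\<close> to the decomposition of \<open>g\<close>
        removes the \<open>p1\<close> term, and the lifting condition rewrites the other
        one.\<close>
      have "\<alpha> l x g = ?d (l + 1) x (\<alpha> (l + 1) x h)"
        using h D f0_lift[of "l + 1" h x] pmod_homD(4)[OF d' \<alpha>h] by (simp add: \<alpha>p1)
      with \<alpha>h show "\<alpha> l x (fst v) \<in> ?d (l + 1) x ` carrier (pspace (?C (l + 1)) x)"
        using v(1) by simp
    next
      assume "\<alpha> l x (fst v) \<in> ?d (l + 1) x ` carrier (pspace (?C (l + 1)) x)"
      then obtain h where h: "h \<in> carrier (pspace (G (l + 1)) x)"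
        "\<alpha> l x g = ?d (l + 1) x (\<alpha> (l + 1) x h)"
        using v(1) by (auto simp flip: \<alpha>_surj)
      interpret V: vectorspace F2 "pspace (G l) x" by (rule persistence_moduleD(1)[OF pm(1)])
      interpret U: vectorspace F2 "pspace (R (l - 1)) x" by (rule persistence_moduleD(1)[OF pm(5)])
      have f0h: "f0 (l + 1) x h \<in> carrier (pspace (G l) x)"
        using D h by simp
      \<comment> \<open>Since \<open>\<alpha> l\<close> does not distinguish \<open>g\<close> from
        \<open>f0 (l + 1) x h\<close>, exactness makes their sum a value of \<open>p1 l\<close>,
        which supplies \<open>r'\<close>.\<close>
      have "\<alpha> l x g = \<alpha> l x (f0 (l + 1) x h)"
        using h f0_lift[of "l + 1" h x] by simp
      then have "\<alpha> l x (f0 (l + 1) x h \<oplus>\<^bsub>pspace (G l) x\<^esub> g) = \<zero>\<^bsub>pspace (?C l) x\<^esub>"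
        using v f0h D pmod_spaceD(4)[OF pm(7)] by simp
      then obtain r' where r': "r' \<in> carrier (pspace (R l) x)"
        "f0 (l + 1) x h \<oplus>\<^bsub>pspace (G l) x\<^esub> g = p1 l x r'"
        using \<alpha>_exact[of l "f0 (l + 1) x h \<oplus>\<^bsub>pspace (G l) x\<^esub> g" x] v f0h by auto
      \<comment> \<open>Adding \<open>f0 (l + 1) x h\<close> twice cancels, which gives
        \<open>g\<close> the shape of the first row.\<close>
      have g: "f0 (l + 1) x h \<oplus>\<^bsub>pspace (G l) x\<^esub> p1 l x r' = g"
        using f0h v by (simp add: F2_add_self[OF persistence_moduleD(1)[OF pm(1)]]
            flip: r'(2) V.a_assoc)
      let ?u = "\<theta> x h \<oplus>\<^bsub>pspace (R (l - 1)) x\<^esub> f1 l x r'"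
      have u: "?u \<in> carrier (pspace (R (l - 1)) x)"
        using D h r' by simp
      \<comment> \<open>Both sides equal \<open>f0 l x g\<close>: the left one by
        \<open>p1_corner\<close>, the right one because \<open>v\<close> is a cycle. So
        \<open>?u\<close> and \<open>r\<close> differ by an element of the kernel of
        \<open>p1 (l - 1)\<close>, and exactness supplies \<open>s\<close>.\<close>
      have "p1 (l - 1) x ?u = p1 (l - 1) x r"
        using p1_corner[OF h(1) r'(1)] g v by simp
      then have "p1 (l - 1) x (?u \<oplus>\<^bsub>pspace (R (l - 1)) x\<^esub> r) = \<zero>\<^bsub>pspace (G (l - 1)) x\<^esub>"
        using v u D pmod_spaceD(4)[OF pm(4)] by simp
      then obtain s where s: "s \<in> carrier (pspace (RR (l - 1)) x)"
        "?u \<oplus>\<^bsub>pspace (R (l - 1)) x\<^esub> r = p2 (l - 1) x s"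
        using p1_exact[of "l - 1" "?u \<oplus>\<^bsub>pspace (R (l - 1)) x\<^esub> r" x] v u by auto
      \<comment> \<open>The same cancellation, now of \<open>?u\<close>, shows that the second row
        gives \<open>r\<close>.\<close>
      have r: "?u \<oplus>\<^bsub>pspace (R (l - 1)) x\<^esub> p2 (l - 1) x s = r"
        using u v U.a_assoc[OF u u v(3)] F2_add_self[OF persistence_moduleD(1)[OF pm(5)] u]
        by (simp flip: s(2))
      show "v \<in> dr x ` carrier (pspace ?E x)"
        using g r h(1) r'(1) s(1) v(1) by (intro image_eqI[of _ _ "(h, r', s)"]) (simp_all add: dr_def)
    qed
  next
    fix x w assume w: "w \<in> carrier (pspace (?C l) x)" "?d l x w = \<zero>\<^bsub>pspace (?C (l - 1)) x\<^esub>"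
    then obtain g where g: "g \<in> carrier (pspace (G l) x)" "w = \<alpha> l x g"
      using \<alpha>_surj[of l x] by auto
    then have "\<alpha> (l - 1) x (f0 l x g) = \<zero>\<^bsub>pspace (?C (l - 1)) x\<^esub>"
      using w f0_lift[of l g x] by simp
    then obtain r where r: "r \<in> carrier (pspace (R (l - 1)) x)" "f0 l x g = p1 (l - 1) x r"
      using g D \<alpha>_exact[of "l - 1" "f0 l x g" x] by auto
    \<comment> \<open>The element \<open>r\<close> obtained from exactness at
      \<open>G (l - 1)\<close> completes the preimage \<open>g\<close> of \<open>w\<close> to a
      cycle.\<close>
    show "\<exists>v\<in>carrier (pspace ?B x). dc x v = \<zero>\<^bsub>pspace (G (l - 1)) x\<^esub> \<and> \<alpha> l x (fst v) = w"
      using g r dc_zero by (intro bexI[of _ "(g, r)"]) auto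
  qed (assumption | rule pm)+
  have "projective ?B" "projective ?E" "projective (G (l - 1))"
    using proj by (auto intro!: projective_sum)
  then have "projective_implicit_rep (homology (?C (l - 1)) (?d l) (?C l) (?d (l + 1)) (?C (l + 1)))
      (G (l - 1)) dc ?B dr ?E"
    unfolding projective_implicit_rep_def using dc dr dcdr iso by blast
  then show ?thesis
    by (simp add: dc_def[abs_def] dr_def[abs_def] case_prod_unfold)
qed

end
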